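(* For every integer $t\ge 3$ and every constant $C$, there exists a constant $n_0$ such that for all $n\ge n_0$, $$L\bigl(K_n\sqcup K_n,\;K_{2,t+1}(t-2)\bigr)>C.$$
   Context: **The strong Ramsey game.** Given a graph $\mathcal{B}$ (the board) and a graph $H$ (the target graph), the strong Ramsey game $R(\mathcal{B},H)$ is the two-player perfect-information game in which players $P_1$ and $P_2$ alternately claim one previously unclaimed edge of $\mathcal{B}$, with $P_1$ moving first. The first player whose set of claimed edges contains a (not necessarily induced) subgraph isomorphic to $H$ wins. If neither player ever achieves this, the game is a draw. **The function $L$.** $L(\mathcal{B},H)$ denotes the minimum number of moves required for $P_1$ to secure victory in $R(\mathcal{B},H)$ regardless of how $P_2$ plays. That is, it is the least $m$ such that $P_1$ has a strategy guaranteeing that, against every play of $P_2$, $P_1$ wins the game within at most $m$ of $P_1$'s own moves (with $L(\mathcal{B},H)=\infty$ if no such $m$ exists). Thus $L(\mathcal{B},H)>C$ means that $P_1$ has no strategy that guarantees a win within $C$ moves. **The board.** $K_n\sqcup K_n$ is the disjoint union of two copies of the complete graph $K_n$. **The target graph.** For integers $t\ge 2$ and $s\ge 0$, $K_{2,t}(s)$ is the graph with $t+s+2$ distinct vertices $a_1,a_2,b_1,\dots,b_t,c_1,\dots,c_s$ whose edges are exactly $a_ib_j$ for all $i\in\{1,2\}$, $j\in\{1,\dots,t\}$, together with $a_1c_i$ for all $i\in\{1,\dots,s\}$. So $K_{2,t+1}(t-2)$ is the complete bipartite graph $K_{2,t+1}$ with $t-2$ pendant edges attached to one vertex of the part of size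 $2$. *)

theory Defs
  imports "HOL-Library.Ramsey" "HOL-Library.Extended_Nat"
begin

record 'a graph =
  verts :: "'a set"
  edges :: "'a set set"

definition simple_graph :: "'a graph \<Rightarrow> bool" where
  "simple_graph G \<longleftrightarrow> edges G \<subseteq> nsets (verts G) 2"

definition complete_graph :: "nat \<Rightarrow> nat graph" where
  "complete_graph n = \<lparr>verts = {..<n}, edges = nsets {..<n} 2\<rparr>"

definition disjoint_union :: "'a graph \<Rightarrow> 'b graph \<Rightarrow> ('a + 'b) graph" where
  "disjoint_union G H =
     \<lparr>verts = verts G <+> verts H,
      edges = (\<lambda>e. Inl ` e) ` edges G \<union> (\<lambda>e. Inr ` e) ` edges H\<rparr>"

datatype label = LA nat | LB nat | LC nat

definition K2 :: "nat \<Rightarrow> nat \<Rightarrow> label graph" where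
  "K2 t s =
     \<lparr>verts = LA ` {1..2} \<union> LB ` {1..t} \<union> LC ` {1..s},
      edges = {{LA i, LB j} | i j. i \<in> {1..2} \<and> j \<in> {1..t}} \<union> {{LA 1, LC i} | i. i \<in> {1..s}}\<rparr>"

text \<open>\<open>G\<close> has a (not necessarily induced) subgraph isomorphic to \<open>H\<close>.\<close>

definition contains_copy :: "'a graph \<Rightarrow> 'b graph \<Rightarrow> bool" where
  "contains_copy G H \<longleftrightarrow>
     (\<exists>f. inj_on f (verts H) \<and> f ` verts H \<subseteq> verts G \<and> (\<forall>e\<in>edges H. f ` e \<in> edges G))"

text \<open>
  A position is the list of edges claimed so far in chronological order. The first player makes
  the moves at indices 0, 2, 4, \<dots>, the second player those at indices 1, 3, 5, \<dots>.
\<close>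

type_synonym 'a position = "'a set list"

definition claimed1 :: "'a position \<Rightarrow> 'a set set" where
  "claimed1 p = {p ! i | i. i < length p \<and> even i}"

definition claimed2 :: "'a position \<Rightarrow> 'a set set" where
  "claimed2 p = {p ! i | i. i < length p \<and> odd i}"

definition has_target1 :: "'a graph \<Rightarrow> 'b graph \<Rightarrow> 'a position \<Rightarrow> bool" where
  "has_target1 B H p \<longleftrightarrow> contains_copy (B\<lparr>edges := claimed1 p\<rparr>) H"

definition has_target2 :: "'a graph \<Rightarrow> 'b graph \<Rightarrow> 'a position \<Rightarrow> bool" where
  "has_target2 B H p \<longleftrightarrow> contains_copy (B\<lparr>edges := claimed2 p\<rparr>) H"

definition game_over :: "'a graph \<Rightarrow> 'b graph \<Rightarrow> 'a position \<Rightarrow> bool" where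
  "game_over B H p \<longleftrightarrow> has_target1 B H p \<or> has_target2 B H p \<or> set p = edges B"

text \<open>
  A strategy (for either player) answers every position in which some edge is still free by a
  free edge. It is prescribed on all such positions, also unreachable ones and those where the
  opponent is to move; these values are never consulted in a play.
\<close>

type_synonym 'a strategy = "'a position \<Rightarrow> 'a set"

definition legal_strategy :: "'a graph \<Rightarrow> 'a strategy \<Rightarrow> bool" where
  "legal_strategy B \<sigma> \<longleftrightarrow>
     (\<forall>p. distinct p \<and> set p \<subset> edges B \<longrightarrow> \<sigma> p \<in> edges B - set p)"

text \<open>
  The position after \<open>k\<close> moves when the first player follows \<open>\<sigma>\<close> and the second player follows
  \<open>\<tau>\<close>; the position stays constant from the moment the game is over. Hence, for a target with
  at least one edge, the first player wins this play iff \<open>has_target1\<close> holds at some \<open>k\<close>.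
\<close>

primrec play :: "'a graph \<Rightarrow> 'b graph \<Rightarrow> 'a strategy \<Rightarrow> 'a strategy \<Rightarrow> nat \<Rightarrow> 'a position" where
  "play B H \<sigma> \<tau> 0 = []"
| "play B H \<sigma> \<tau> (Suc k) =
     (let p = play B H \<sigma> \<tau> k in
      if game_over B H p then p else p @ [if even (length p) then \<sigma> p else \<tau> p])"

text \<open>The number of moves counted is that of the first player's own moves only.\<close>

definition guarantees_win_within :: "'a graph \<Rightarrow> 'b graph \<Rightarrow> 'a strategy \<Rightarrow> nat \<Rightarrow> bool" where
  "guarantees_win_within B H \<sigma> m \<longleftrightarrow>
     (\<forall>\<tau>. legal_strategy B \<tau> \<longrightarrow>
        (\<exists>k. has_target1 B H (play B H \<sigma> \<tau> k) \<and> card (claimed1 (play B H \<sigma> \<tau> k)) \<le> m))"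

text \<open>The infimum of the empty set in \<^typ>\<open>enat\<close> is \<open>\<infinity>\<close>.\<close>

definition L :: "'a graph \<Rightarrow> 'b graph \<Rightarrow> enat" where
  "L B H = Inf {enat m | m. \<exists>\<sigma>. legal_strategy B \<sigma> \<and> guarantees_win_within B H \<sigma> m}"

lemma simple_graph_complete_graph: "simple_graph (complete_graph n)"
  by (simp add: simple_graph_def complete_graph_def)

lemma simple_graph_disjoint_union:
  assumes "simple_graph G" "simple_graph H"
  shows "simple_graph (disjoint_union G H)"
proof -
  have "Inl ` e \<in> nsets (verts G <+> verts H) 2" if "e \<in> edges G" for e
  proof -
    have "e \<subseteq> verts G" "finite e" "card e = 2"
      using assms that by (auto simp: simple_graph_def nsets_def)
    then show ?thesis
      by (auto simp: nsets_def card_image)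
  qed
  moreover have "Inr ` e \<in> nsets (verts G <+> verts H) 2" if "e \<in> edges H" for e
  proof -
    have "e \<subseteq> verts H" "finite e" "card e = 2"
      using assms that by (auto simp: simple_graph_def nsets_def)
    then show ?thesis
      by (auto simp: nsets_def card_image)
  qed
  ultimately show ?thesis
    by (auto simp: simple_graph_def disjoint_union_def)
qed

lemma simple_graph_K2: "simple_graph (K2 t s)"
  by (auto simp: simple_graph_def K2_def nsets_def)

lemma legal_strategy_exists: "\<exists>\<sigma>. legal_strategy B \<sigma>"
proof -
  have "legal_strategy B (\<lambda>p. SOME e. e \<in> edges B - set p)"
    unfolding legal_strategy_def
  proof (intro allI impI, elim conjE)
    fix p assume "set p \<subset> edges B"
    then show "(SOME e. e \<in> edges B - set p) \<in> edges B - set p"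
      by (rule someI_ex[OF psubset_imp_ex_mem])
  qed
  then show ?thesis
    by blast
qed

lemma L_greater_iff:
  "enat C < L B H \<longleftrightarrow>
     (\<forall>\<sigma>. legal_strategy B \<sigma> \<longrightarrow> \<not> guarantees_win_within B H \<sigma> C)"
proof -
  let ?S = "{enat m | m. \<exists>\<sigma>. legal_strategy B \<sigma> \<and> guarantees_win_within B H \<sigma> m}"
  have mono: "guarantees_win_within B H \<sigma> m'"
    if "guarantees_win_within B H \<sigma> m" "m \<le> m'" for \<sigma> m m'
    using that unfolding guarantees_win_within_def by (meson le_trans)
  have iff: "L B H \<le> enat C \<longleftrightarrow>
      (\<exists>\<sigma>. legal_strategy B \<sigma> \<and> guarantees_win_within B H \<sigma> C)"
  proof
    assume le: "L B H \<le> enat C"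
    then have "?S \<noteq> {}"
      unfolding L_def Inf_enat_def by (auto simp del: Collect_empty_eq split: if_splits)
    then obtain x where "x \<in> ?S"
      by blast
    then have "(LEAST y. y \<in> ?S) \<in> ?S"
      by (rule LeastI)
    with \<open>?S \<noteq> {}\<close> have "L B H \<in> ?S"
      by (simp only: L_def Inf_enat_def if_False)
    then obtain m \<sigma> where "L B H = enat m" "legal_strategy B \<sigma>" "guarantees_win_within B H \<sigma> m"
      by blast
    with le mono show "\<exists>\<sigma>. legal_strategy B \<sigma> \<and> guarantees_win_within B H \<sigma> C"
      by (metis enat_ord_simps(1))
  next
    assume "\<exists>\<sigma>. legal_strategy B \<sigma> \<and> guarantees_win_within B H \<sigma> C"
    then show "L B H \<le> enat C"
      unfolding L_def by (intro Inf_lower) blast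
  qed
  show ?thesis
    unfolding not_le[symmetric] iff by blast
qed

end

theory Submission imports Defs begin

text \<open>
  The second player survives as long as needed because she can reach a position from which she
  makes one threat after another. The target has \<open>3t\<close> edges: a big centre of degree \<open>2t - 1\<close>, a small
  centre of degree \<open>t + 1\<close>, and all neighbours of the small centre are neighbours of the big one.

  Endgame. Suppose that the second player owns a \<open>K\<^bsub>2,t\<^esub>\<close> with centres \<open>x\<close> and \<open>y\<close> and that \<open>x\<close>
  has at least \<open>2t - 1\<close> neighbours. Joining one centre to an untouched vertex \<open>v\<close> threatens to join
  the other centre \<open>d\<close> to \<open>v\<close>, and the first player has to claim \<open>dv\<close>. These forced answers form a
  star at \<open>d\<close> whose leaves are untouched otherwise. Such a star contributes only edges at one centre,
  so that a first player who is far from a copy at the start never gets a threat of his own, and the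
  threats go on as long as there are untouched vertices (\<open>threats_forever\<close>, \<open>endgame\<close>).

  Way to the endgame. The first player opens in one clique, and the second player builds in the other
  one, first a star from \<open>x\<close> to a set \<open>S\<close> of \<open>2t - 1\<close> leaves. Then she picks an untouched \<open>y\<close> and
  claims edges from \<open>y\<close> to \<open>S\<close>; with \<open>t + 1\<close> of them she has won. When \<open>y\<close> is picked, the first player
  owns \<open>2t\<close> edges. If he only blocks, that is, claims edges from \<open>y\<close> to \<open>S\<close> himself, she gets \<open>t\<close> leaves
  and he gets \<open>t - 1\<close>. When he makes a different move for the first time, he owns \<open>2t + 1\<close> edges
  besides the blocks. There are two cases.

  \<^item> No copy of the target contains these \<open>2t + 1\<close> edges. Then every copy lacks at least \<open>t\<close> edges, which
    is too many to finish before the battle at \<open>y\<close> is decided (\<open>battle_without_guard\<close>).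
  \<^item> Some copy with centres \<open>p\<close>, \<open>q\<close> contains them. The second player guards the pair: the potential,
    the number of his edges at the pair whose mirror image is not hers, is \<open>2t + 1\<close>, and since this is
    odd there is a mirror image that she can claim. Keeping the potential at most \<open>2t\<close> kills all copies
    on this pair, for these need \<open>2t + 2\<close>, while any other copy has at least \<open>t + 1\<close> edges outside
    the pair, and he does not have the time for so many (\<open>battle_with_guard\<close>).

  If she does not win the battle, then it ends with her owning a \<open>K\<^bsub>2,t\<^esub>\<close> and with her to move. In the
  guarded case the first player has no threat (\<open>safe_guarded\<close>). In the other case
  he might, as the edges that he claimed in the second clique may join up with his blocks at \<open>y\<close>. Counting shows that this requires
  one of few very special configurations (\<open>unsafe_copy\<close>), and these are excluded by letting the second
  player prefer certain leaves during the battle and choose the centre \<open>d\<close> at its end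
  (\<open>preference_exists\<close>).
\<close>

section \<open>Surviving a game for a given number of rounds\<close>

text \<open>
  A position is reduced to the sets \<open>R\<close> and \<open>B\<close> of edges claimed by the first and by the second player,
  because the order of the moves has no influence on the further game. As in
  \<^const>\<open>guarantees_win_within\<close>, only moves of the first player are counted.
\<close>

primrec survives :: "'e set \<Rightarrow> ('e set \<Rightarrow> bool) \<Rightarrow> nat \<Rightarrow> 'e set \<Rightarrow> 'e set \<Rightarrow> bool" where
  "survives E win 0 R B = True"
| "survives E win (Suc k) R B =
     (\<forall>e\<in>E - R - B. \<not> win (insert e R) \<and>
        (\<exists>f\<in>E - insert e R - B. win (insert f B) \<or> survives E win k (insert e R) (insert f B)))"

definition can_reply :: "'e set \<Rightarrow> ('e set \<Rightarrow> bool) \<Rightarrow> nat \<Rightarrow> 'e set \<Rightarrow> 'e set \<Rightarrow> bool" where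
  "can_reply E win k R B \<longleftrightarrow>
     (\<exists>f\<in>E - R - B. win (insert f B) \<or> survives E win k R (insert f B))"

lemma survives_Suc:
  "survives E win (Suc k) R B \<longleftrightarrow>
     (\<forall>e\<in>E - R - B. \<not> win (insert e R) \<and> can_reply E win k (insert e R) B)"
  by (simp only: can_reply_def survives.simps)

lemma claimed_snoc:
  "claimed1 (p @ [e]) = (if even (length p) then insert e (claimed1 p) else claimed1 p)"
  "claimed2 (p @ [e]) = (if even (length p) then claimed2 p else insert e (claimed2 p))"
proof -
  have 1: "{(p @ [e]) ! i | i. i < length (p @ [e]) \<and> Q i} =
      (if Q (length p) then insert e {p ! i | i. i < length p \<and> Q i} else {p ! i | i. i < length p \<and> Q i})"
    for Q
  proof -
    have "{(p @ [e]) ! i | i. i < length (p @ [e]) \<and> Q i} = (\<lambda>i. (p @ [e]) ! i) ` {i. i < Suc (length p) \<and> Q i}"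
      by auto
    also have "{i. i < Suc (length p) \<and> Q i} =
        {i. i < length p \<and> Q i} \<union> (if Q (length p) then {length p} else {})"
      by (auto simp: less_Suc_eq)
    also have "(\<lambda>i. (p @ [e]) ! i) ` ({i. i < length p \<and> Q i} \<union> (if Q (length p) then {length p} else {})) =
        (\<lambda>i. p ! i) ` {i. i < length p \<and> Q i} \<union> (if Q (length p) then {e} else {})"
      unfolding image_Un by (intro arg_cong2[where f = "(\<union>)"] image_cong) (auto simp: nth_append)
    also have "(\<lambda>i. p ! i) ` {i. i < length p \<and> Q i} = {p ! i | i. i < length p \<and> Q i}"
      by auto
    finally show ?thesis by simp
  qed
  show "claimed1 (p @ [e]) = (if even (length p) then insert e (claimed1 p) else claimed1 p)"
    unfolding claimed1_def by (rule 1)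
  show "claimed2 (p @ [e]) = (if even (length p) then claimed2 p else insert e (claimed2 p))"
    unfolding claimed2_def 1 by simp
qed

lemma claimed_Nil: "claimed1 [] = {}" "claimed2 [] = {}"
  by (auto simp: claimed1_def claimed2_def)

lemma claimed_union: "claimed1 p \<union> claimed2 p = set p"
proof -
  have "p ! i \<in> claimed1 p \<union> claimed2 p" if "i < length p" for i
    unfolding claimed1_def claimed2_def using that by (cases "even i") auto
  then show ?thesis
    by (auto simp: in_set_conv_nth) (auto simp: claimed1_def claimed2_def)
qed

lemma finite_claimed1: "finite (claimed1 p)"
  by (rule finite_subset[of _ "set p"]) (use claimed_union in auto)

text \<open>
  A strategy for the second player is read off from \<^const>\<open>survives\<close>: she always picks an edge that
  either wins or leads to a position which survives for the remaining number of moves.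
\<close>

lemma survives_imp_L_greater:
  fixes Bd :: "'a graph" and H :: "'b graph"
  defines "win \<equiv> \<lambda>G. contains_copy (Bd\<lparr>edges := G\<rparr>) H"
  assumes surv: "survives (edges Bd) win C {} {}" and nowin: "\<not> win {}"
  shows "L Bd H > enat C"
  unfolding L_greater_iff
proof (intro allI impI notI)
  fix \<sigma> assume \<sigma>: "legal_strategy Bd \<sigma>" and guar: "guarantees_win_within Bd H \<sigma> C"
  define E where "E = edges Bd"
  define good where "good p f \<longleftrightarrow> f \<in> E - set p \<and>
      (win (insert f (claimed2 p)) \<or>
       survives E win (C - card (claimed1 p)) (claimed1 p) (insert f (claimed2 p)))" for p f
  define \<tau> where "\<tau> p = (if \<exists>f. good p f then SOME f. good p f else SOME f. f \<in> E - set p)" for p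
  have \<tau>_good: "good p (\<tau> p)" if "\<exists>f. good p f" for p
    using that someI_ex[OF that] by (simp add: \<tau>_def)
  have \<tau>: "legal_strategy Bd \<tau>"
    unfolding legal_strategy_def
  proof (intro allI impI, elim conjE)
    fix p assume "set p \<subset> edges Bd"
    then have "\<exists>f. f \<in> E - set p" by (auto simp: E_def)
    then have "(SOME f. f \<in> E - set p) \<in> E - set p" by (rule someI_ex)
    then show "\<tau> p \<in> edges Bd - set p"
      using \<tau>_good[of p] unfolding \<tau>_def good_def E_def by auto
  qed
  \<comment> \<open>Positions with more than \<open>C\<close> moves of the first player do not matter.\<close>
  define inv where "inv p \<longleftrightarrow> distinct p \<and> set p \<subseteq> E \<and>
     (card (claimed1 p) > C \<or>
      (\<not> win (claimed1 p) \<and>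
       (win (claimed2 p) \<or>
        (if even (length p) then survives E win (C - card (claimed1 p)) (claimed1 p) (claimed2 p)
         else can_reply E win (C - card (claimed1 p)) (claimed1 p) (claimed2 p)))))" for p
  have "inv (play Bd H \<sigma> \<tau> k)" for k
  proof (induction k)
    case 0
    then show ?case using surv nowin by (simp add: inv_def claimed_Nil E_def)
  next
    case (Suc k)
    define p where "p = play Bd H \<sigma> \<tau> k"
    have ip: "inv p" using Suc p_def by simp
    show ?case
    proof (cases "game_over Bd H p")
      case True
      then have "play Bd H \<sigma> \<tau> (Suc k) = p" by (simp add: p_def Let_def)
      then show ?thesis using ip by simp
    next
      case False
      define m where "m = (if even (length p) then \<sigma> p else \<tau> p)"
      have pl: "play Bd H \<sigma> \<tau> (Suc k) = p @ [m]"
        using False by (simp add: p_def m_def Let_def)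
      from False have nw: "\<not> win (claimed1 p)" "\<not> win (claimed2 p)" and "set p \<noteq> E"
        by (auto simp: game_over_def has_target1_def has_target2_def win_def E_def)
      with ip have ps: "set p \<subset> E" "distinct p" by (auto simp: inv_def)
      then have m: "m \<in> E - set p"
        using \<sigma> \<tau> by (auto simp: m_def legal_strategy_def E_def)
      have base: "distinct (p @ [m])" "set (p @ [m]) \<subseteq> E" using m ps by auto
      have m1: "m \<notin> claimed1 p" "m \<notin> claimed2 p" using m claimed_union[of p] by auto
      show ?thesis
      proof (cases "card (claimed1 (p @ [m])) > C")
        case True
        then show ?thesis using pl base by (simp add: inv_def)
      next
        case le: False
        have le': "card (claimed1 p) \<le> C"
          using le card_mono[OF finite_claimed1[of "p @ [m]"], of "claimed1 p"]
          by (simp add: claimed_snoc subset_insertI split: if_splits)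
        show ?thesis
        proof (cases "even (length p)")
          case ev: True
          have s: "survives E win (C - card (claimed1 p)) (claimed1 p) (claimed2 p)"
            using ip le' nw ev by (simp add: inv_def)
          have c: "card (claimed1 (p @ [m])) = Suc (card (claimed1 p))"
            using ev m1 finite_claimed1[of p] by (simp add: claimed_snoc)
          then have "C - card (claimed1 p) = Suc (C - card (claimed1 (p @ [m])))"
            using le by simp
          then have "survives E win (Suc (C - card (claimed1 (p @ [m])))) (claimed1 p) (claimed2 p)"
            using s by (simp only:)
          moreover have "m \<in> E - claimed1 p - claimed2 p" using m m1 by auto
          ultimately have "\<not> win (claimed1 (p @ [m]))"
            "can_reply E win (C - card (claimed1 (p @ [m]))) (claimed1 (p @ [m])) (claimed2 (p @ [m]))"
            using ev unfolding survives_Suc by (simp_all add: claimed_snoc)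
          then show ?thesis
            using base ev unfolding pl inv_def by simp
        next
          case od: False
          have s: "can_reply E win (C - card (claimed1 p)) (claimed1 p) (claimed2 p)"
            using ip le' nw od by (simp add: inv_def)
          have "E - claimed1 p - claimed2 p = E - set p" using claimed_union[of p] by auto
          with s have "\<exists>f. good p f" by (auto simp: can_reply_def good_def)
          then have "good p m" using \<tau>_good od by (simp add: m_def)
          then have "win (claimed2 (p @ [m])) \<or> survives E win (C - card (claimed1 (p @ [m])))
              (claimed1 (p @ [m])) (claimed2 (p @ [m]))" "\<not> win (claimed1 (p @ [m]))"
            using od nw unfolding good_def by (simp_all add: claimed_snoc)
          then show ?thesis
            using base od unfolding pl inv_def by auto
        qed
      qed
    qed
  qed
  then have "\<not> (has_target1 Bd H (play Bd H \<sigma> \<tau> k) \<and> card (claimed1 (play Bd H \<sigma> \<tau> k)) \<le> C)" for k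
    unfolding inv_def has_target1_def win_def by (meson not_less)
  with guar \<tau> show False unfolding guarantees_win_within_def by blast
qed

section \<open>Copies of the target as sets of edges\<close>

definition spokes :: "'v \<Rightarrow> 'v set \<Rightarrow> 'v set set" where
  "spokes c A = (\<lambda>z. {c, z}) ` A"

text \<open>
  A copy is given by its set of edges, which makes it possible to count how much of it is claimed;
  \<open>a\<close> is the centre that carries the pendant edges.
\<close>

definition target_copy :: "nat \<Rightarrow> 'v \<Rightarrow> 'v \<Rightarrow> 'v set set \<Rightarrow> bool" where
  "target_copy t a b K \<longleftrightarrow>
     (\<exists>N P. finite N \<and> finite P \<and> card N = t + 1 \<and> card P = t - 2 \<and> N \<inter> P = {} \<and> a \<noteq> b \<and>
        a \<notin> N \<union> P \<and> b \<notin> N \<union> P \<and> K = spokes a (N \<union> P) \<union> spokes b N)"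

abbreviation edges_at :: "'v set set \<Rightarrow> 'v \<Rightarrow> 'v set set" where
  "edges_at K v \<equiv> {g \<in> K. v \<in> g}"

abbreviation nbrs :: "'v set set \<Rightarrow> 'v \<Rightarrow> 'v set" where
  "nbrs K v \<equiv> {z. {v, z} \<in> K}"

lemma in_spokes: "g \<in> spokes c A \<longleftrightarrow> (\<exists>z\<in>A. g = {c, z})"
  by (auto simp: spokes_def)

lemma finite_spokes [simp]: "finite A \<Longrightarrow> finite (spokes c A)"
  by (simp add: spokes_def)

lemma doubleton_in_spokes [simp]: "{c, l} \<in> spokes c A \<longleftrightarrow> l \<in> A"
  by (auto simp: in_spokes doubleton_eq_iff)

lemma card_spokes: "card (spokes c A) = card A"
  unfolding spokes_def by (rule card_image) (auto simp: inj_on_def doubleton_eq_iff)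

lemma spokes_insert: "spokes c (insert v A) = insert {c, v} (spokes c A)"
  by (simp add: spokes_def)

locale target =
  fixes t :: nat and a b :: 'v and K :: "'v set set"
  assumes t3: "t \<ge> 3" and copy: "target_copy t a b K"
begin

lemma decomposition:
  obtains N P where "finite N" "finite P" "card N = t + 1" "card P = t - 2" "N \<inter> P = {}"
    "a \<noteq> b" "a \<notin> N" "a \<notin> P" "b \<notin> N" "b \<notin> P" "K = spokes a (N \<union> P) \<union> spokes b N"
  using copy unfolding target_copy_def by auto

lemma finite_K: "finite K"
  by (rule decomposition) simp

lemma centres_neq: "a \<noteq> b"
  by (rule decomposition)

lemma one_centre: "g \<in> K \<Longrightarrow> (a \<in> g) \<noteq> (b \<in> g)"
  by (rule decomposition) (auto simp: in_spokes)

lemma edge_cases: "g \<in> K \<Longrightarrow> \<exists>z. z \<noteq> a \<and> z \<noteq> b \<and> (g = {a, z} \<or> g = {b, z})"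
  by (rule decomposition) (auto simp: in_spokes)

lemma edges_at_a: "edges_at K a = spokes a (nbrs K a)" and edges_at_b: "edges_at K b = spokes b (nbrs K b)"
  by (rule decomposition, auto simp: in_spokes doubleton_eq_iff)+

lemma card_nbrs_a: "card (nbrs K a) = 2 * t - 1"
proof (rule decomposition)
  fix N P assume *: "finite N" "finite P" "card N = t + 1" "card P = t - 2" "N \<inter> P = {}"
    "a \<noteq> b" "a \<notin> N" "a \<notin> P" "b \<notin> N" "b \<notin> P" "K = spokes a (N \<union> P) \<union> spokes b N"
  then have "nbrs K a = N \<union> P" by (auto simp: in_spokes doubleton_eq_iff)
  then show ?thesis using * t3 by (simp add: card_Un_disjoint)
qed

lemma card_nbrs_b: "card (nbrs K b) = t + 1"
  and nbrs_b_subset: "nbrs K b \<subseteq> nbrs K a"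
proof -
  obtain N P where *: "finite N" "finite P" "card N = t + 1" "card P = t - 2" "N \<inter> P = {}"
    "a \<noteq> b" "a \<notin> N" "a \<notin> P" "b \<notin> N" "b \<notin> P" "K = spokes a (N \<union> P) \<union> spokes b N"
    by (rule decomposition)
  then have "nbrs K b = N" "nbrs K a = N \<union> P" by (auto simp: in_spokes doubleton_eq_iff)
  then show "card (nbrs K b) = t + 1" "nbrs K b \<subseteq> nbrs K a" using * by auto
qed

lemma card_at_a: "card (edges_at K a) = 2 * t - 1"
  by (simp add: edges_at_a card_spokes card_nbrs_a)

lemma card_at_b: "card (edges_at K b) = t + 1"
  by (simp add: edges_at_b card_spokes card_nbrs_b)

lemma K_split: "K = edges_at K a \<union> edges_at K b" "edges_at K a \<inter> edges_at K b = {}"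
  using edge_cases one_centre by auto

lemma card_K: "card K = 3 * t"
proof -
  have "card K = card (edges_at K a) + card (edges_at K b)"
    using card_Un_disjoint[of "edges_at K a" "edges_at K b"] K_split finite_K by simp
  then show ?thesis using t3 by (simp add: card_at_a card_at_b)
qed

lemma card_at_centre: "c \<in> {a, b} \<Longrightarrow> card (edges_at K c) \<ge> t + 1"
  using card_at_a card_at_b t3 by auto

lemma edges_at_other: "v \<noteq> a \<Longrightarrow> v \<noteq> b \<Longrightarrow> edges_at K v \<subseteq> {{a, v}, {b, v}}"
  using edge_cases by fastforce

lemma card_at_other: "v \<noteq> a \<Longrightarrow> v \<noteq> b \<Longrightarrow> card (edges_at K v) \<le> 2"
proof -
  assume "v \<noteq> a" "v \<noteq> b"
  then have "card (edges_at K v) \<le> card {{a, v}, {b, v}}"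
    by (intro card_mono edges_at_other) auto
  also have "\<dots> \<le> 2" by (simp add: card_insert_if)
  finally show ?thesis .
qed

lemma common_nbrs:
  assumes "c \<in> {a, b}" "d \<in> {a, b}" "c \<noteq> d"
  shows "card (nbrs K c \<inter> nbrs K d) = t + 1"
proof -
  have "nbrs K c \<inter> nbrs K d = nbrs K b" using assms nbrs_b_subset by auto
  then show ?thesis by (simp add: card_nbrs_b)
qed

lemma finite_nbrs: "finite (nbrs K v)"
proof -
  have "nbrs K v \<subseteq> \<Union> K" by auto
  moreover have "finite (\<Union> K)"
    using finite_K edge_cases by (intro finite_Union) auto
  ultimately show ?thesis by (rule finite_subset)
qed

text \<open>
  The worst case is that \<open>y\<close> is the big centre, when the edges at the small centre are left. So a star
  of forced answers always leaves at least four edges of a copy to be claimed elsewhere.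
\<close>

lemma card_avoiding: "card {g \<in> K. y \<notin> g} \<ge> t + 1"
proof -
  have "card {g \<in> K. y \<notin> g} + card (edges_at K y) = card K"
    using finite_K by (subst card_Un_disjoint[symmetric]) (auto intro: arg_cong[where f = card])
  moreover have "card (edges_at K y) \<le> 2 * t - 1"
  proof (cases "y \<in> {a, b}")
    case True then show ?thesis using card_at_a card_at_b t3 by auto
  next
    case False then show ?thesis using card_at_other[of y] t3 by auto
  qed
  ultimately show ?thesis using card_K t3 by linarith
qed

text \<open>
  The extreme case is that exactly one of \<open>a1\<close>, \<open>a2\<close> is the big centre. The other vertex has at most
  two edges in the copy, and if it has any, then one of them is the edge \<open>a1a2\<close>, which contains both
  vertices and does not count.
\<close>

lemma card_pair_edges_le:
  assumes ne: "{a, b} \<noteq> {a1, a2}" and "a1 \<noteq> a2"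
  shows "card {g \<in> K. (a1 \<in> g) \<noteq> (a2 \<in> g)} \<le> 2 * t - 1"
proof -
  have one: "card {g \<in> K. (p \<in> g) \<noteq> (q \<in> g)} \<le> 2 * t - 1"
    if p: "p \<in> {a, b}" and q: "q \<notin> {a, b}" for p q
  proof -
    define r where "r = (if p = a then b else a)"
    have qr: "edges_at K q \<subseteq> {{p, q}, {r, q}}"
      using edges_at_other[of q] p q by (auto simp: r_def)
    let ?X = "{g \<in> K. (p \<in> g) \<noteq> (q \<in> g)}"
    have sub: "?X \<subseteq> (edges_at K p - {{p, q}}) \<union> (if {r, q} \<in> K then {{r, q}} else {})"
      using qr by auto
    have fin: "finite (edges_at K p)" using finite_K by simp
    have pc: "p = a \<and> card (edges_at K p) = 2 * t - 1 \<or> p = b \<and> card (edges_at K p) = t + 1"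
      using p card_at_a card_at_b by auto
    show ?thesis
    proof (cases "{r, q} \<in> K")
      case False
      then have "card ?X \<le> card (edges_at K p - {{p, q}})" using sub fin by (intro card_mono) auto
      also have "\<dots> \<le> card (edges_at K p)" using fin by (intro card_mono) auto
      finally show ?thesis using pc t3 by linarith
    next
      case True
      have "?X \<subseteq> insert {r, q} (edges_at K p - {{p, q}})" using sub True by auto
      then have "card ?X \<le> card (insert {r, q} (edges_at K p - {{p, q}}))"
        using fin by (intro card_mono) auto
      also have "\<dots> \<le> Suc (card (edges_at K p - {{p, q}}))" by (rule card_insert_le_m1) auto
      finally have X: "card ?X \<le> Suc (card (edges_at K p - {{p, q}}))" .
      show ?thesis
      proof (cases "p = a")
        case pa: True
        then have "q \<in> nbrs K b" using True by (simp add: r_def)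
        then have "{p, q} \<in> edges_at K p" using nbrs_b_subset pa by auto
        then have "card (edges_at K p - {{p, q}}) = card (edges_at K p) - 1"
          using fin by simp
        then show ?thesis using X pa card_at_a t3 by simp
      next
        case False
        then have "card (edges_at K p) = t + 1" using pc by auto
        moreover have "card (edges_at K p - {{p, q}}) \<le> card (edges_at K p)"
          using fin by (intro card_mono) auto
        ultimately show ?thesis using X t3 by linarith
      qed
    qed
  qed
  consider "a1 \<in> {a, b}" "a2 \<notin> {a, b}" | "a2 \<in> {a, b}" "a1 \<notin> {a, b}"
    | "a1 \<notin> {a, b}" "a2 \<notin> {a, b}"
    using assms by auto
  then show ?thesis
  proof cases
    case 1 then show ?thesis by (rule one)
  next
    case 2
    have "{g \<in> K. (a1 \<in> g) \<noteq> (a2 \<in> g)} = {g \<in> K. (a2 \<in> g) \<noteq> (a1 \<in> g)}" by auto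
    with one[OF 2] show ?thesis by simp
  next
    case 3
    have "card {g \<in> K. (a1 \<in> g) \<noteq> (a2 \<in> g)} \<le> card (edges_at K a1 \<union> edges_at K a2)"
      using finite_K by (intro card_mono) auto
    also have "\<dots> \<le> card (edges_at K a1) + card (edges_at K a2)" by (rule card_Un_le)
    also have "\<dots> \<le> 4" using 3 card_at_other[of a1] card_at_other[of a2] by auto
    finally show ?thesis using t3 by linarith
  qed
qed

lemma card_off_pair_ge:
  assumes "{a, b} \<noteq> {a1, a2}" "a1 \<noteq> a2"
  shows "card {g \<in> K. \<not> ((a1 \<in> g) \<noteq> (a2 \<in> g))} \<ge> t + 1"
proof -
  have "card {g \<in> K. \<not> ((a1 \<in> g) \<noteq> (a2 \<in> g))} + card {g \<in> K. (a1 \<in> g) \<noteq> (a2 \<in> g)} = card K"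
    using finite_K by (subst card_Un_disjoint[symmetric]) (auto intro: arg_cong[where f = card])
  then show ?thesis using card_pair_edges_le[OF assms] card_K t3 by linarith
qed

end

lemma target_copyI:
  assumes "x \<noteq> y" "x \<notin> S" "y \<notin> S" "P \<subseteq> S" "finite S" "t \<ge> 2" "card P \<ge> t + 1" "card S \<ge> 2 * t - 1"
  obtains K where "target_copy t x y K" "K \<subseteq> spokes x S \<union> spokes y P"
proof -
  obtain N where N: "N \<subseteq> P" "card N = t + 1"
    using assms(7) obtain_subset_with_card_n by metis
  have fN: "finite N" using N by (metis card.infinite add_is_0 one_neq_zero)
  have "card (S - N) \<ge> t - 2"
    using card_Diff_subset[of N S] N assms fN by auto
  then obtain Q where Q: "Q \<subseteq> S - N" "card Q = t - 2" "finite Q"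
    using obtain_subset_with_card_n by (metis assms(5) finite_Diff finite_subset)
  have "target_copy t x y (spokes x (N \<union> Q) \<union> spokes y N)"
    unfolding target_copy_def using N Q assms fN by (intro exI[of _ N] exI[of _ Q]) (auto simp: in_spokes)
  moreover have "spokes x (N \<union> Q) \<union> spokes y N \<subseteq> spokes x S \<union> spokes y P"
    unfolding spokes_def using N Q assms by blast
  ultimately show ?thesis using that by blast
qed

section \<open>The board and the endgame\<close>

text \<open>
  The first edge of the game lies in the clique on \<open>VA\<close>, and the second player builds in the clique on
  \<open>VB\<close>, whose size \<open>n\<close> has to leave her untouched vertices. The winning condition is a parameter, so that the locale
  can be used with the two cliques in either order.
\<close>

locale board =
  fixes VA VB :: "'v set" and n t :: nat and win :: "'v set set \<Rightarrow> bool"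
  assumes t3: "t \<ge> 3" and fin: "finite VA" "finite VB" and card_VB: "card VB = n"
    and disj: "VA \<inter> VB = {}"
    and win_iff: "\<And>G. G \<subseteq> nsets VA 2 \<union> nsets VB 2 \<Longrightarrow>
          win G \<longleftrightarrow> (\<exists>a b K. target_copy t a b K \<and> K \<subseteq> G)"
begin

abbreviation E :: "'v set set" where "E \<equiv> nsets VA 2 \<union> nsets VB 2"
abbreviation reply :: "nat \<Rightarrow> 'v set set \<Rightarrow> 'v set set \<Rightarrow> bool" where
  "reply \<equiv> can_reply E win"

lemma finite_E: "finite E"
  using fin by (simp add: finite_imp_finite_nsets)

lemma edge_in_VB [simp]: "c \<in> VB \<Longrightarrow> {c, z} \<in> E \<longleftrightarrow> z \<in> VB \<and> c \<noteq> z"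
  using disj by (auto simp: nsets_def card_insert_if split: if_splits)

lemma edge_in_VA [simp]: "c \<in> VA \<Longrightarrow> {c, z} \<in> E \<longleftrightarrow> z \<in> VA \<and> c \<noteq> z"
  using disj by (auto simp: nsets_def card_insert_if split: if_splits)

lemma edge_card: "e \<in> E \<Longrightarrow> card e = 2"
  by (auto simp: nsets_def)

lemma targetI: "target_copy t a b K \<Longrightarrow> target t a b K"
  using t3 by unfold_locales auto

lemma winE:
  assumes "win G" "G \<subseteq> E"
  obtains a b K where "target t a b K" "K \<subseteq> G"
proof -
  from assms obtain a b K where "target_copy t a b K" "K \<subseteq> G"
    using win_iff[OF assms(2)] by blast
  then show ?thesis using that[of a b K] targetI[of a b K] by simp
qed

text \<open>
  Copies are connected: each neighbour of the small centre is joined to both centres.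
\<close>

lemma copy_on_one_side:
  assumes "target t a b K" "K \<subseteq> E"
  shows "K \<subseteq> nsets VA 2 \<or> K \<subseteq> nsets VB 2"
proof -
  interpret target t a b K by fact
  have "nbrs K b \<noteq> {}" using card_nbrs_b by (metis card.empty add_is_0 one_neq_zero)
  then obtain z where z: "{b, z} \<in> K" "{a, z} \<in> K" using nbrs_b_subset by blast
  have side: "z' \<in> V" if "{u, z'} \<in> nsets V 2 \<union> nsets W 2" "u \<in> V" "V \<inter> W = {}"
    for u z' and V W :: "'v set"
    using that by (auto simp: nsets_def)
  have *: "K \<subseteq> nsets V 2" if V: "a \<in> V" "V \<inter> W = {}" "K \<subseteq> nsets V 2 \<union> nsets W 2"
    for V W :: "'v set"
  proof
    fix g assume g: "g \<in> K"
    have "z \<in> V" using side[of a z V W] z V by auto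
    then have "b \<in> V" using side[of z b V W] z V by (auto simp: insert_commute)
    then have "\<not> g \<inter> V = {}" using edge_cases[OF g] V(1) by auto
    moreover have "g \<in> nsets V 2 \<or> g \<in> nsets W 2" using g V(3) by auto
    ultimately show "g \<in> nsets V 2" using V(2) unfolding nsets_def by auto
  qed
  have "a \<in> VA \<or> a \<in> VB" using z(2) assms(2) unfolding nsets_def by auto
  then show ?thesis
  proof
    assume "a \<in> VA" then show ?thesis using *[of VA VB] disj assms(2) by simp
  next
    assume "a \<in> VB"
    moreover have "VB \<inter> VA = {}" using disj by auto
    moreover have "K \<subseteq> nsets VB 2 \<union> nsets VA 2" using assms(2) by auto
    ultimately show ?thesis using *[of VB VA] by simp
  qed
qed

lemma no_win_if_few:
  assumes "G \<subseteq> E" "card G < 3 * t"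
  shows "\<not> win G"
proof
  assume "win G"
  then obtain a b K where K: "target t a b K" "K \<subseteq> G" using winE assms by metis
  then have "3 * t \<le> card G"
    using target.card_K[OF K(1)] card_mono[of G K] finite_subset[OF assms(1) finite_E] by simp
  then show False using assms by simp
qed

text \<open>
  Two further edges per round touch at most four further vertices. So this bound is inherited from
  round to round, and it leaves an untouched vertex even if two vertices are reserved.
\<close>

definition room :: "nat \<Rightarrow> 'v set set \<Rightarrow> 'v set set \<Rightarrow> bool" where
  "room k R B \<longleftrightarrow> R \<subseteq> E \<and> B \<subseteq> E \<and> R \<inter> B = {} \<and> 2 * (card R + card B) + 4 * k + 3 \<le> n"

lemma roomD: "room k R B \<Longrightarrow> R \<subseteq> E" "room k R B \<Longrightarrow> B \<subseteq> E" "room k R B \<Longrightarrow> R \<inter> B = {}"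
  "room k R B \<Longrightarrow> finite R" "room k R B \<Longrightarrow> finite B"
  unfolding room_def by (auto intro: finite_subset[OF _ finite_E])

lemma fresh_vertex:
  assumes "room k R B" "card W \<le> 2" "finite W"
  obtains v where "v \<in> VB" "v \<notin> \<Union> (R \<union> B)" "v \<notin> W"
proof -
  have RB: "R \<union> B \<subseteq> E" "finite (R \<union> B)" using roomD[OF assms(1)] by auto
  have "card (\<Union> (R \<union> B)) \<le> sum card (R \<union> B)" by (rule card_Union_le_sum_card)
  also have "\<dots> = 2 * card (R \<union> B)"
    using RB edge_card by (subst sum.cong[of _ "R \<union> B" _ "\<lambda>_. 2"]) auto
  also have "\<dots> \<le> 2 * (card R + card B)" using card_Un_le[of R B] by simp
  finally have "card (\<Union> (R \<union> B)) \<le> 2 * (card R + card B)" .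
  then have "card (\<Union> (R \<union> B) \<union> W) \<le> 2 * (card R + card B) + 2"
    using card_Un_le[of "\<Union> (R \<union> B)" W] assms(2) by linarith
  then have "card (\<Union> (R \<union> B) \<union> W) < card VB"
    using assms(1) card_VB unfolding room_def by linarith
  moreover have "finite (\<Union> (R \<union> B) \<union> W)"
    using RB assms(3) by (auto simp: nsets_def)
  ultimately have "\<not> VB \<subseteq> \<Union> (R \<union> B) \<union> W" using card_mono leD by blast
  then show ?thesis using that by blast
qed

lemma room_step:
  assumes "room (Suc k) R B" "f \<in> E - R - B" "e \<in> E" "e \<notin> R" "e \<notin> insert f B"
  shows "room k (insert e R) (insert f B)"
  using assms roomD[OF assms(1)] unfolding room_def by auto

lemma reply_win: "f \<in> E \<Longrightarrow> f \<notin> R \<Longrightarrow> f \<notin> B \<Longrightarrow> win (insert f B) \<Longrightarrow> reply k R B"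
  unfolding can_reply_def by auto

lemma replyI:
  assumes "room k R B" "f \<in> E" "f \<notin> R" "f \<notin> B"
    and "\<And>k' e. k = Suc k' \<Longrightarrow> e \<in> E \<Longrightarrow> e \<notin> R \<Longrightarrow> e \<notin> insert f B \<Longrightarrow>
           room k' (insert e R) (insert f B) \<Longrightarrow>
           \<not> win (insert e R) \<and> reply k' (insert e R) (insert f B)"
  shows "reply k R B"
proof -
  have "survives E win k R (insert f B)"
  proof (cases k)
    case 0 then show ?thesis by simp
  next
    case (Suc k')
    show ?thesis unfolding Suc survives_Suc
    proof
      fix e assume "e \<in> E - R - insert f B"
      then show "\<not> win (insert e R) \<and> reply k' (insert e R) (insert f B)"
        using assms Suc by (intro assms(5) room_step) auto
    qed
  qed
  then show ?thesis unfolding can_reply_def using assms(2-4) by (intro bexI[of _ f]) auto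
qed

text \<open>
  The first player has no winning move, not even after he has been forced to claim any number of edges
  from \<open>d\<close> to vertices untouched so far.
\<close>

definition safe :: "'v set set \<Rightarrow> 'v set set \<Rightarrow> 'v \<Rightarrow> bool" where
  "safe R B d \<longleftrightarrow> (\<forall>F e. finite F \<longrightarrow> F \<subseteq> VB \<longrightarrow> F \<inter> \<Union> (R \<union> B) = {} \<longrightarrow> e \<in> E \<longrightarrow> e \<notin> R \<longrightarrow> e \<notin> B \<longrightarrow>
     \<not> win (insert e (R \<union> spokes d F)))"

lemma win_spokes:
  assumes "x \<in> VB" "y \<in> VB" "x \<noteq> y" "S \<subseteq> VB" "x \<notin> S" "y \<notin> S" "P \<subseteq> S"
    "card P \<ge> t + 1" "card S \<ge> 2 * t - 1" "spokes x S \<union> spokes y P \<subseteq> B" "B \<subseteq> E"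
  shows "win B"
proof -
  have "finite S" using assms(4) fin finite_subset by blast
  then obtain K where K: "target_copy t x y K" "K \<subseteq> spokes x S \<union> spokes y P"
    using target_copyI[of x y S P t] assms t3 by (metis One_nat_def Suc_1 Suc_leD numeral_3_eq_3)
  from K(2) assms(10) have "K \<subseteq> B" by (rule order_trans)
  with K(1) show ?thesis unfolding win_iff[OF assms(11)] by (intro exI conjI)
qed

text \<open>
  Each round the second player joins \<open>c\<close> to an untouched vertex \<open>v\<close>. If the answer is not \<open>dv\<close>, she
  claims \<open>dv\<close> and wins; otherwise \<open>v\<close> is added to \<open>F\<close>.
\<close>

lemma threats_forever:
  assumes safe: "safe R0 B0 d" and cd: "c \<in> VB" "d \<in> VB" "c \<noteq> d" "c \<in> \<Union> B0" "d \<in> \<Union> B0"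
    and wins: "\<And>v B. v \<in> VB \<Longrightarrow> v \<notin> \<Union> B0 \<Longrightarrow> B0 \<subseteq> B \<Longrightarrow> B \<subseteq> E \<Longrightarrow>
           {c, v} \<in> B \<Longrightarrow> {d, v} \<in> B \<Longrightarrow> win B"
    and "finite F" "F \<subseteq> VB" "F \<inter> \<Union> (R0 \<union> B0) = {}" "B0 \<subseteq> B"
    and "room k (R0 \<union> spokes d F) B"
  shows "reply k (R0 \<union> spokes d F) B"
  using assms(8-)
proof (induction k arbitrary: F B rule: less_induct)
  case (less k)
  let ?R = "R0 \<union> spokes d F"
  obtain v where v: "v \<in> VB" "v \<notin> \<Union> (?R \<union> B)"
    using fresh_vertex[OF less.prems(5), of "{}"] by auto
  have vcd: "v \<noteq> c" "v \<noteq> d" using v less.prems cd by auto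
  have vR: "v \<notin> g" if "g \<in> ?R \<union> B" for g using v(2) that by blast
  have dv: "{d, v} \<notin> ?R" "{d, v} \<notin> B" "{c, v} \<notin> ?R" "{c, v} \<notin> B"
    using vR[of "{d, v}"] vR[of "{c, v}"] by blast+
  show ?case
  proof (rule replyI[OF less.prems(5), of "{c, v}"])
    show "{c, v} \<in> E" using v vcd cd by simp
    fix k' e assume k': "k = Suc k'" and e: "e \<in> E" "e \<notin> ?R" "e \<notin> insert {c, v} B"
      and rm: "room k' (insert e ?R) (insert {c, v} B)"
    have "e \<notin> R0" "e \<notin> B0" using e less.prems(4) by auto
    then have "\<not> win (insert e ?R)"
      using safe[unfolded safe_def, rule_format, of F e] less.prems(1-3) e(1) by simp
    moreover have "reply k' (insert e ?R) (insert {c, v} B)"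
    proof (cases "e = {d, v}")
      case True
      have eq: "insert e ?R = R0 \<union> spokes d (insert v F)"
        using True by (simp add: spokes_insert)
      have "v \<notin> \<Union> (R0 \<union> B0)" using vR less.prems(4) by blast
      then show ?thesis unfolding eq
        using less.prems v k' rm eq by (intro less.IH) auto
    next
      case False
      have "{d, v} \<noteq> {c, v}" using cd vcd by (auto simp: doubleton_eq_iff)
      moreover have "v \<notin> \<Union> B0" using vR less.prems(4) by blast
      ultimately show ?thesis
        using False dv v vcd cd less.prems roomD(2)[OF rm]
        by (intro reply_win[of "{d, v}"] wins[of v]) auto
    qed
    ultimately show "\<not> win (insert e ?R) \<and> reply k' (insert e ?R) (insert {c, v} B)" by simp
  qed (use dv in auto)
qed

end

text \<open>
  The centre \<open>x\<close> with leaves \<open>S\<close> is the star of the second player, and \<open>y\<close> is the vertex that is to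
  become her second centre.
\<close>

locale double_star = board +
  fixes x y :: 'a and S :: "'a set"
  assumes xy: "x \<in> VB" "y \<in> VB" "x \<noteq> y" and S: "S \<subseteq> VB" "card S = 2 * t - 1" "x \<notin> S" "y \<notin> S"
begin

lemma finite_S: "finite S"
  using S fin finite_subset by blast

abbreviation taken :: "'a set set \<Rightarrow> 'a set" where
  "taken R \<equiv> {l \<in> S. {y, l} \<in> R}"

lemma spokes_neq [simp]: "l \<in> S \<Longrightarrow> {y, l} \<notin> spokes x A"
  using xy S by (auto simp: in_spokes doubleton_eq_iff)

text \<open>
  Either centre may play the role of \<open>d\<close>: in both cases a new common neighbour of \<open>x\<close> and \<open>y\<close>
  completes the target, with pendant edges at \<open>x\<close>.
\<close>

lemma endgame:
  assumes safe: "safe R B d" and d: "d \<in> {x, y}"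
    and B: "spokes x S \<union> spokes y P \<subseteq> B" "P \<subseteq> S" "card P = t" and rm: "room k R B"
  shows "reply k R B"
proof -
  define c where "c = (if d = x then y else x)"
  have "S \<noteq> {}" "P \<noteq> {}" using S t3 B by auto
  then obtain s p where sp: "s \<in> S" "p \<in> P" by auto
  have in_B: "x \<in> \<Union> B" "y \<in> \<Union> B"
  proof -
    have "{x, s} \<in> B" "{y, p} \<in> B" using sp B(1) unfolding spokes_def by auto
    then show "x \<in> \<Union> B" "y \<in> \<Union> B" by auto
  qed
  have cd': "c \<in> VB" "d \<in> VB" "c \<noteq> d" "c \<in> \<Union> B" "d \<in> \<Union> B"
    using d xy in_B by (auto simp: c_def)
  have none: "R \<union> spokes d {} = R" by (simp add: spokes_def)
  have "reply k (R \<union> spokes d {}) B"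
  proof (rule threats_forever[OF safe cd', where F = "{}" and B = B])
    show "room k (R \<union> spokes d {}) B" using rm none by simp
    fix v B' assume v: "v \<in> VB" "v \<notin> \<Union> B" "B \<subseteq> B'" "B' \<subseteq> E" "{c, v} \<in> B'" "{d, v} \<in> B'"
    have xv: "{x, v} \<in> B'" "{y, v} \<in> B'" using v d by (auto simp: c_def split: if_splits)
    have vS: "v \<notin> S"
      using v(2) B(1) unfolding spokes_def by blast
    have "finite P" using B finite_S finite_subset by blast
    show "win B'"
    proof (rule win_spokes[of x y "insert v S" "insert v P"])
      show "t + 1 \<le> card (insert v P)" using vS B \<open>finite P\<close> by (subst card_insert_disjoint) auto
      show "2 * t - 1 \<le> card (insert v S)" using vS S finite_S by auto
      show "x \<notin> insert v S" "y \<notin> insert v S" using v in_B S by auto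
      show "spokes x (insert v S) \<union> spokes y (insert v P) \<subseteq> B'"
        using xv B v by (auto simp: spokes_insert)
    qed (use v xy S B in auto)
  qed simp_all
  then show ?thesis unfolding none .
qed

lemma taken_insert: "taken (insert e R) \<subseteq> taken R \<or> (\<exists>l\<in>S. e = {y, l} \<and> taken (insert e R) = insert l (taken R))"
proof (cases "\<exists>l\<in>S. e = {y, l}")
  case True
  then obtain l where l: "l \<in> S" "e = {y, l}" by blast
  have "{y, l'} = {y, l} \<longleftrightarrow> l' = l" for l' by (auto simp: doubleton_eq_iff)
  then have "taken (insert e R) = insert l (taken R)" using l by auto
  then show ?thesis using l by blast
next
  case False
  then have "taken (insert e R) \<subseteq> taken R" by auto
  then show ?thesis ..
qed

text \<open>
  By taking leaves in \<open>X\<close> as long as there are open ones, the second player gets at least as many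
  leaves of \<open>X\<close> as her opponent, because she moves first at \<open>y\<close>. The inequality is restored after each
  answer \<open>e\<close>.
\<close>

lemma pick_preferred:
  assumes X: "X \<subseteq> S" and le: "card (taken R \<inter> X) \<le> card (P \<inter> X)" and P: "P \<subseteq> S"
    and B: "spokes y P \<subseteq> B" and o: "o1 \<in> S" "o1 \<notin> P" "o1 \<notin> taken R"
  obtains l where "l \<in> S" "l \<notin> P" "l \<notin> taken R"
    "\<forall>e. e \<notin> R \<longrightarrow> e \<notin> insert {y, l} B \<longrightarrow>
       card (taken (insert e R) \<inter> X) \<le> card (insert l P \<inter> X)"
proof (cases "\<exists>l\<in>X. l \<notin> P \<and> l \<notin> taken R")
  case True
  then obtain l where l: "l \<in> X" "l \<notin> P" "l \<notin> taken R" by blast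
  have fP: "finite P" using P finite_S finite_subset by blast
  have "card (taken (insert e R) \<inter> X) \<le> card (insert l P \<inter> X)" for e
  proof -
    have "card (taken (insert e R) \<inter> X) \<le> Suc (card (taken R \<inter> X))"
    proof -
      obtain l' where "taken (insert e R) \<subseteq> insert l' (taken R)"
        using taken_insert[of e R] by auto
      then have "taken (insert e R) \<inter> X \<subseteq> insert l' (taken R \<inter> X)" by auto
      then have "card (taken (insert e R) \<inter> X) \<le> card (insert l' (taken R \<inter> X))"
        using finite_S by (intro card_mono) auto
      also have "\<dots> \<le> Suc (card (taken R \<inter> X))" by (rule card_insert_le_m1) auto
      finally show ?thesis .
    qed
    also have "\<dots> \<le> Suc (card (P \<inter> X))" using le by simp
    also have "\<dots> = card (insert l P \<inter> X)" using l fP by simp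
    finally show ?thesis .
  qed
  then show ?thesis using that l X by blast
next
  case False
  have "card (taken (insert e R) \<inter> X) \<le> card (insert o1 P \<inter> X)" if e: "e \<notin> R" "e \<notin> insert {y, o1} B" for e
  proof -
    have "taken (insert e R) \<inter> X \<subseteq> taken R \<inter> X"
    proof
      fix l assume l: "l \<in> taken (insert e R) \<inter> X"
      show "l \<in> taken R \<inter> X"
      proof (rule ccontr)
        assume "l \<notin> taken R \<inter> X"
        then have "e = {y, l}" "l \<notin> taken R" "l \<in> X" using l by auto
        then have "l \<in> P" using False by auto
        then have "e \<in> B" using B \<open>e = {y, l}\<close> unfolding spokes_def by auto
        then show False using e by simp
      qed
    qed
    then have "card (taken (insert e R) \<inter> X) \<le> card (taken R \<inter> X)"
      using finite_S by (intro card_mono) auto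
    also have "\<dots> \<le> card (P \<inter> X)" by (rule le)
    also have "\<dots> \<le> card (insert o1 P \<inter> X)"
      using P finite_S finite_subset[OF P] by (intro card_mono) auto
    finally show ?thesis .
  qed
  then show ?thesis using that o by blast
qed

section \<open>The battle for the second centre\<close>

lemma y_edge_in_E: "l \<in> S \<Longrightarrow> {y, l} \<in> E"
  using xy S by auto

lemma card_leaves:
  assumes "P \<subseteq> S" "taken R \<inter> P = {}" "\<And>l. l \<in> S \<Longrightarrow> l \<in> P \<or> l \<in> taken R"
  shows "card (taken R) + card P = 2 * t - 1"
proof -
  have "S = taken R \<union> P" using assms(1,3) by auto
  then have "card S = card (taken R) + card P"
    using card_Un_disjoint[of "taken R" P] assms(1,2) finite_S finite_subset[OF assms(1)] by auto
  then show ?thesis using S by simp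
qed

lemma taken_disjoint:
  assumes "R \<inter> B = {}" "spokes y P \<subseteq> B"
  shows "taken R \<inter> P = {}"
  using assms unfolding spokes_def by auto

lemma card_spokes_taken_le: "finite J \<Longrightarrow> spokes y (taken R) \<subseteq> J \<Longrightarrow> card (taken R) \<le> card J"
  using card_mono[of J "spokes y (taken R)"] by (simp add: card_spokes)

text \<open>
  Since no copy contains \<open>G0\<close>, a win of the first player needs more than \<open>3t\<close> edges in total. The number
  of his edges is tied to \<open>card P\<close>, so by then \<open>P\<close> would have \<open>t + 1\<close> elements. If all leaves are gone
  before that, then besides \<open>G0\<close> he owns \<open>t - 1\<close> blocks and nothing else, and the endgame starts.
\<close>

lemma battle_without_guard:
  assumes G0: "G0 \<subseteq> R" "card G0 = 2 * t + 1" "\<And>a b K. target t a b K \<Longrightarrow> K \<subseteq> E \<Longrightarrow> \<not> G0 \<subseteq> K"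
      "\<And>l. l \<in> S \<Longrightarrow> {y, l} \<notin> G0"
    and X: "X \<subseteq> S" "card (taken R \<inter> X) \<le> card (P \<inter> X)"
    and P: "P \<subseteq> S" "card P \<le> t" "card R = 2 * t + card P"
    and fin_safe: "\<And>T. T \<subseteq> S \<Longrightarrow> card T = t - 1 \<Longrightarrow> 2 * card (T \<inter> X) \<le> card X \<Longrightarrow>
        \<exists>d\<in>{x, y}. safe (G0 \<union> spokes y T) (spokes x S \<union> spokes y (S - T)) d"
    and rm: "room k R (spokes x S \<union> spokes y P)"
  shows "reply k R (spokes x S \<union> spokes y P)"
  using G0(1) X(2) P rm
proof (induction k arbitrary: R P rule: less_induct)
  case (less k)
  let ?B = "spokes x S \<union> spokes y P"
  note rd = roomD[OF less.prems(6)]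
  have yPB: "spokes y P \<subseteq> ?B" by auto
  have dj: "taken R \<inter> P = {}" by (rule taken_disjoint[OF rd(3) yPB])
  show ?case
  proof (cases "\<exists>l\<in>S. l \<notin> P \<and> l \<notin> taken R")
    case True
    then obtain o1 where o1: "o1 \<in> S" "o1 \<notin> P" "o1 \<notin> taken R" by blast
    obtain l where l: "l \<in> S" "l \<notin> P" "l \<notin> taken R" and
      pref: "\<forall>e. e \<notin> R \<longrightarrow> e \<notin> insert {y, l} ?B \<longrightarrow>
         card (taken (insert e R) \<inter> X) \<le> card (insert l P \<inter> X)"
      by (rule pick_preferred[OF X(1) less.prems(2) less.prems(3) yPB o1])
    have eqB: "insert {y, l} ?B = spokes x S \<union> spokes y (insert l P)" by (simp add: spokes_insert)
    have fP: "finite P" using less.prems(3) finite_S finite_subset by blast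
    have cP: "card (insert l P) = Suc (card P)" using l fP by simp
    have lR: "{y, l} \<notin> R" "{y, l} \<notin> ?B" using l by auto
    show ?thesis
    proof (cases "card P = t")
      case True
      have "win (insert {y, l} ?B)"
      proof (rule win_spokes[of x y S "insert l P"])
        show "spokes x S \<union> spokes y (insert l P) \<subseteq> insert {y, l} ?B" unfolding eqB ..
        show "insert {y, l} ?B \<subseteq> E" using rd(2) y_edge_in_E[OF l(1)] by auto
      qed (use xy S less.prems l cP True in auto)
      then show ?thesis using lR y_edge_in_E[OF l(1)] by (intro reply_win)
    next
      case False
      show ?thesis
      proof (rule replyI[OF less.prems(6) y_edge_in_E[OF l(1)] lR])
        fix k' e assume k': "k = Suc k'" and e: "e \<in> E" "e \<notin> R" "e \<notin> insert {y, l} ?B"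
          and rm': "room k' (insert e R) (insert {y, l} ?B)"
        have cR: "card (insert e R) = 2 * t + card (insert l P)"
          using less.prems(5) e(2) rd(4) cP by simp
        have cl: "card (insert l P) \<le> t" using cP False less.prems(4) by simp
        have "\<not> win (insert e R)"
        proof
          assume "win (insert e R)"
          then obtain a b K where K: "target t a b K" "K \<subseteq> insert e R"
            using winE rd(1) e(1) by (metis insert_subset)
          have "card (insert e R) \<le> card K" using target.card_K[OF K(1)] cR cl by simp
          then have "K = insert e R" using K(2) rd(4) by (intro card_seteq) auto
          then show False using G0(3)[OF K(1)] less.prems(1) rd(1) e(1) by auto
        qed
        moreover have "reply k' (insert e R) (insert {y, l} ?B)"
          unfolding eqB
        proof (rule less.IH)
          show "card (taken (insert e R) \<inter> X) \<le> card (insert l P \<inter> X)" using pref e by simp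
          show "room k' (insert e R) (spokes x S \<union> spokes y (insert l P))" using rm' eqB by simp
        qed (use k' less.prems l cR cl in auto)
        ultimately show "\<not> win (insert e R) \<and> reply k' (insert e R) (insert {y, l} ?B)" by simp
      qed
    qed
  next
    case False
    let ?T = "taken R"
    have sum: "card ?T + card P = 2 * t - 1" using False dj less.prems(3) by (intro card_leaves) auto
    have sub: "spokes y ?T \<subseteq> R - G0" using G0(4) by (auto simp: in_spokes)
    have cR: "card R = card G0 + card (R - G0)"
      using less.prems(1) rd(4) by (metis card_Diff_subset card_mono finite_subset le_add_diff_inverse)
    have le: "card ?T \<le> card (R - G0)" using rd(4) sub by (intro card_spokes_taken_le) auto
    have cPt: "card P = t" "card ?T = t - 1"
      using sum le cR G0(2) less.prems(4,5) by linarith+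
    have "card (R - G0) \<le> card (spokes y ?T)"
      using cR cPt G0(2) less.prems(5) t3 by (simp add: card_spokes)
    \<comment> \<open>Leaves and edges are counted exactly, so that all edges outside \<open>G0\<close> are blocks.\<close>
    then have "spokes y ?T = R - G0" using sub rd(4) by (intro card_seteq) auto
    then have R: "R = G0 \<union> spokes y ?T" using less.prems(1) by auto
    have SP: "S - ?T = P" using False dj less.prems(3) by auto
    have "2 * card (?T \<inter> X) \<le> card X"
    proof -
      have "X = (?T \<inter> X) \<union> (P \<inter> X)" using False X(1) by auto
      then have "card X = card (?T \<inter> X) + card (P \<inter> X)"
        using card_Un_disjoint[of "?T \<inter> X" "P \<inter> X"] dj finite_S finite_subset[OF less.prems(3)] by auto
      then show ?thesis using less.prems(2) by simp
    qed
    then obtain d where "d \<in> {x, y}" "safe R ?B d"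
      using fin_safe[of ?T] cPt R SP by auto
    then show ?thesis using endgame[of R ?B d P k] less.prems cPt by auto
  qed
qed

text \<open>
  Mirror images with respect to a pair \<open>p\<close>, \<open>q\<close> are \<open>{p, z}\<close> and \<open>{q, z}\<close>. A vertex \<open>z\<close> is open as a
  neighbour of \<open>p\<close> if the first player owns \<open>{p, z}\<close> and may still get \<open>{q, z}\<close>, or has it already.
\<close>

definition open_nbrs :: "'a \<Rightarrow> 'a \<Rightarrow> 'a set set \<Rightarrow> 'a set set \<Rightarrow> 'a set" where
  "open_nbrs p q R B = {z. z \<noteq> p \<and> z \<noteq> q \<and> {p, z} \<in> R \<and> {q, z} \<notin> B}"

definition potential :: "'a \<Rightarrow> 'a \<Rightarrow> 'a set set \<Rightarrow> 'a set set \<Rightarrow> nat" where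
  "potential p q R B = card (open_nbrs p q R B) + card (open_nbrs q p R B)"

definition off_pair :: "'a \<Rightarrow> 'a \<Rightarrow> 'a set set \<Rightarrow> 'a set set" where
  "off_pair p q R = {g \<in> R. (p \<in> g) = (q \<in> g)}"

lemma potential_sym: "potential p q R B = potential q p R B"
  by (simp add: potential_def)

lemma finite_open_nbrs: "finite R \<Longrightarrow> R \<subseteq> E \<Longrightarrow> finite (open_nbrs p q R B)"
proof -
  assume "finite R" "R \<subseteq> E"
  then have "finite (\<Union> R)" by (auto simp: nsets_def)
  moreover have "open_nbrs p q R B \<subseteq> \<Union> R" by (auto simp: open_nbrs_def)
  ultimately show ?thesis by (rule rev_finite_subset)
qed

lemma open_nbrs_insert:
  "open_nbrs p q (insert e R) B \<subseteq> open_nbrs p q R B \<union> {z. z \<noteq> p \<and> z \<noteq> q \<and> e = {p, z}}"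
  by (auto simp: open_nbrs_def)

lemma potential_off_pair:
  assumes "(p \<in> e) = (q \<in> e)" "p \<noteq> q"
  shows "potential p q (insert e R) B = potential p q R B"
proof -
  have "open_nbrs p q (insert e R) B = open_nbrs p q R B"
    "open_nbrs q p (insert e R) B = open_nbrs q p R B"
    using assms by (auto simp: open_nbrs_def)
  then show ?thesis by (simp add: potential_def)
qed

lemma potential_insert_le:
  assumes "finite R" "R \<subseteq> E" "p \<noteq> q"
  shows "potential p q (insert e R) B \<le> Suc (potential p q R B)"
proof -
  have *: "card (open_nbrs p' q' (insert e R) B) \<le> Suc (card (open_nbrs p' q' R B))" for p' q'
  proof -
    obtain z0 where "{z. z \<noteq> p' \<and> z \<noteq> q' \<and> e = {p', z}} \<subseteq> {z0}"
      by (cases "\<exists>z. e = {p', z}") (auto simp: doubleton_eq_iff)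
    then have "open_nbrs p' q' (insert e R) B \<subseteq> insert z0 (open_nbrs p' q' R B)"
      using open_nbrs_insert[of p' q' e R B] by auto
    then have "card (open_nbrs p' q' (insert e R) B) \<le> card (insert z0 (open_nbrs p' q' R B))"
      using finite_open_nbrs[OF assms(1,2)] by (intro card_mono) auto
    also have "\<dots> \<le> Suc (card (open_nbrs p' q' R B))" by (rule card_insert_le_m1) auto
    finally show ?thesis .
  qed
  have same: "open_nbrs p' q' (insert e R) B = open_nbrs p' q' R B" if "p' \<notin> e" for p' q'
    using that by (auto simp: open_nbrs_def)
  consider "p \<notin> e" | "q \<notin> e" | "p \<in> e" "q \<in> e" by blast
  then show ?thesis
  proof cases
    case 1 then show ?thesis using same[of p q] *[of q p] by (simp add: potential_def)
  next
    case 2 then show ?thesis using same[of q p] *[of p q] by (simp add: potential_def)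
  next
    case 3 then show ?thesis using potential_off_pair[of p e q R B] assms by simp
  qed
qed

text \<open>
  Each of the \<open>t + 1\<close> common neighbours is open on both sides.
\<close>

lemma potential_of_copy:
  assumes K: "target t a b K" "{a, b} = {p, q}" "K \<subseteq> R" and RB: "R \<inter> B = {}" "finite R" "R \<subseteq> E"
  shows "potential p q R B \<ge> 2 * t + 2"
proof -
  interpret target t a b K by (rule K)
  have pq: "p \<in> {a, b}" "q \<in> {a, b}" "p \<noteq> q" using K(2) centres_neq by (auto simp: doubleton_eq_iff)
  let ?Z = "nbrs K p \<inter> nbrs K q"
  have Z: "card ?Z = t + 1" by (rule common_nbrs[OF pq])
  have ne: "z \<noteq> p" "z \<noteq> q" if "z \<in> ?Z" for z
    using that one_centre[of "{p, z}"] one_centre[of "{q, z}"] pq by auto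
  have "?Z \<subseteq> open_nbrs p q R B" "?Z \<subseteq> open_nbrs q p R B"
    using ne K(3) RB(1) by (auto simp: open_nbrs_def)
  then have "t + 1 \<le> card (open_nbrs p q R B)" "t + 1 \<le> card (open_nbrs q p R B)"
    using Z card_mono[OF finite_open_nbrs[OF RB(2,3)], of ?Z] by metis+
  then show ?thesis by (simp add: potential_def)
qed

lemma potential_le_card:
  assumes "finite G" "p \<noteq> q" "\<And>z. {p, z} \<in> R \<Longrightarrow> {p, z} \<in> G" "\<And>z. {q, z} \<in> R \<Longrightarrow> {q, z} \<in> G"
  shows "potential p q R B \<le> card G"
proof -
  have "potential p q R B = card (spokes p (open_nbrs p q R B)) + card (spokes q (open_nbrs q p R B))"
    by (simp add: potential_def card_spokes)
  also have "\<dots> = card (spokes p (open_nbrs p q R B) \<union> spokes q (open_nbrs q p R B))"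
  proof (rule card_Un_disjoint[symmetric])
    show "finite (spokes p (open_nbrs p q R B))" "finite (spokes q (open_nbrs q p R B))"
      using assms by (auto intro!: finite_subset[OF _ assms(1)] simp: open_nbrs_def in_spokes)
    show "spokes p (open_nbrs p q R B) \<inter> spokes q (open_nbrs q p R B) = {}"
      using assms(2) by (auto simp: open_nbrs_def in_spokes doubleton_eq_iff)
  qed
  also have "\<dots> \<le> card G"
    using assms by (intro card_mono) (auto simp: open_nbrs_def in_spokes)
  finally show ?thesis .
qed

text \<open>
  If every mirror image of an open edge were claimed by the first player, then the open neighbours of
  \<open>p\<close> and of \<open>q\<close> would be the same and the potential would be even.
\<close>

lemma block_exists:
  assumes "odd (potential p q R B)" and RB: "R \<inter> B = {}" "finite R" "R \<subseteq> E" and pq: "p \<in> VA" "q \<in> VA" "p \<noteq> q"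
  obtains f where "f \<in> nsets VA 2" "f \<notin> R" "f \<notin> B" "potential p q R (insert f B) < potential p q R B"
proof -
  note result = that
  have one: thesis if C: "z \<in> open_nbrs p' q' R B" "z \<notin> open_nbrs q' p' R B"
    and pq': "p' \<in> VA" "q' \<in> VA" "p' \<noteq> q'" "potential p' q' = potential p q" for p' q' z
  proof (rule result)
    have z: "z \<noteq> p'" "z \<noteq> q'" "{p', z} \<in> R" "{q', z} \<notin> B" using C by (auto simp: open_nbrs_def)
    have "{p', z} \<notin> B" using z RB by auto
    then show fR: "{q', z} \<notin> R" using C z by (auto simp: open_nbrs_def)
    show "{q', z} \<notin> B" by fact
    have "{p', z} \<in> E" using z RB by auto
    then have "z \<in> VA" using pq' disj by auto
    then show "{q', z} \<in> nsets VA 2" using pq' z by simp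
    have fin: "finite (open_nbrs p' q' R B)" "finite (open_nbrs q' p' R B)"
      using finite_open_nbrs RB by auto
    have "open_nbrs p' q' R (insert {q', z} B) \<subseteq> open_nbrs p' q' R B - {z}"
      by (auto simp: open_nbrs_def)
    then have "card (open_nbrs p' q' R (insert {q', z} B)) < card (open_nbrs p' q' R B)"
      using C fin by (intro psubset_card_mono) auto
    moreover have "card (open_nbrs q' p' R (insert {q', z} B)) \<le> card (open_nbrs q' p' R B)"
      using fin by (intro card_mono) (auto simp: open_nbrs_def)
    ultimately show "potential p q R (insert {q', z} B) < potential p q R B"
      unfolding pq'(4)[symmetric] potential_def by linarith
  qed
  have "open_nbrs p q R B \<noteq> open_nbrs q p R B"
    using assms(1) unfolding potential_def by auto
  then consider z where "z \<in> open_nbrs p q R B" "z \<notin> open_nbrs q p R B"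
    | z where "z \<in> open_nbrs q p R B" "z \<notin> open_nbrs p q R B" by blast
  then show thesis
  proof cases
    case 1 then show thesis using one[of z p q] pq by simp
  next
    case 2 then show thesis using one[of z q p] pq potential_sym[of p q] by (simp add: fun_eq_iff)
  qed
qed

lemma no_win_guarded:
  assumes RB: "R \<inter> B = {}" "finite R" "R \<subseteq> E" and pq: "p \<noteq> q"
    and pot: "potential p q R B \<le> 2 * t + 1" and off: "card (off_pair p q R) \<le> t"
  shows "\<not> win R"
proof
  assume "win R"
  then obtain a b K where K: "target t a b K" "K \<subseteq> R" using winE RB(3) by metis
  show False
  proof (cases "{a, b} = {p, q}")
    case True
    then show False using potential_of_copy[OF K(1) True K(2) RB] pot by simp
  next
    case False
    have "t + 1 \<le> card {g \<in> K. \<not> ((p \<in> g) \<noteq> (q \<in> g))}"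
      by (rule target.card_off_pair_ge[OF K(1) False pq])
    also have "\<dots> \<le> card (off_pair p q R)"
      using K(2) RB(2) by (intro card_mono) (auto simp: off_pair_def)
    finally show False using off by simp
  qed
qed

text \<open>
  The set \<open>T\<close> stands for the blocks. A copy on the pair \<open>p\<close>, \<open>q\<close> fails because one move raises the
  potential by at most one. Any other copy needs \<open>t + 1\<close> edges outside the pair if it lies in \<open>VA\<close>, and
  \<open>t + 1\<close> edges avoiding \<open>y\<close> if it lies in \<open>VB\<close>; including \<open>e\<close> there are only two of either kind.
\<close>

lemma safe_guarded:
  assumes RB: "R \<inter> B = {}" "finite R" "R \<subseteq> E" and pq: "p \<noteq> q" "p \<in> VA" "q \<in> VA"
    and pot: "potential p q R B \<le> 2 * t" and off: "card (off_pair p q R - spokes y T) \<le> 1"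
    and yB: "y \<in> \<Union> B"
  shows "safe R B y"
  unfolding safe_def
proof (intro allI impI notI)
  fix F e assume F: "finite F" "F \<subseteq> VB" "F \<inter> \<Union> (R \<union> B) = {}" and e: "e \<in> E" "e \<notin> R" "e \<notin> B"
    and "win (insert e (R \<union> spokes y F))"
  let ?U = "insert e (R \<union> spokes y F)"
  have "y \<notin> F" using F(3) yB by auto
  then have "{y, v} \<in> E" if "v \<in> F" for v using that F(2) xy by auto
  then have "spokes y F \<subseteq> E" unfolding spokes_def by blast
  then have UE: "?U \<subseteq> E" using e RB by simp
  obtain a b K where K: "target t a b K" "K \<subseteq> ?U"
    using winE[OF \<open>win ?U\<close> UE] by blast
  have KE: "K \<subseteq> E" using K(2) UE by (rule order_trans)
  show False
  proof (cases "{a, b} = {p, q}")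
    case True
    have "\<not> K \<subseteq> nsets VB 2"
    proof
      assume VB: "K \<subseteq> nsets VB 2"
      have "edges_at K a \<noteq> {}" using target.card_at_a[OF K(1)] t3 by (intro notI) simp
      then obtain g where "g \<in> K" "a \<in> g" by blast
      then have "a \<in> VB" using VB by (auto simp: nsets_def)
      moreover have "a \<in> VA" using True pq by (auto simp: doubleton_eq_iff)
      ultimately show False using disj by auto
    qed
    then have KA: "K \<subseteq> nsets VA 2" using copy_on_one_side[OF K(1) KE] by simp
    have "K \<subseteq> insert e R"
    proof
      fix g assume g: "g \<in> K"
      then have "y \<notin> g" using KA xy disj by (auto simp: nsets_def)
      then show "g \<in> insert e R" using g K(2) by (auto simp: in_spokes)
    qed
    then have "2 * t + 2 \<le> potential p q (insert e R) B"
      using e RB by (intro potential_of_copy[OF K(1) True]) auto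
    then show False using pot potential_insert_le[OF RB(2,3) pq(1), of e B] by simp
  next
    case False
    have le2: "card (insert e (off_pair p q R - spokes y T)) \<le> 2" 
      using off card_insert_le_m1[of 2 "off_pair p q R - spokes y T" e] by simp
    have fin: "finite (insert e (off_pair p q R - spokes y T))"
      using RB by (simp add: off_pair_def)
    consider "K \<subseteq> nsets VA 2" | "K \<subseteq> nsets VB 2" using copy_on_one_side[OF K(1) KE] by blast
    then show False
    proof cases
      case 1
      have "{g \<in> K. \<not> ((p \<in> g) \<noteq> (q \<in> g))} \<subseteq> insert e (off_pair p q R - spokes y T)"
      proof
        fix g assume "g \<in> {g \<in> K. \<not> ((p \<in> g) \<noteq> (q \<in> g))}"
        moreover from this have "y \<notin> g" using 1 xy disj by (auto simp: nsets_def)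
        ultimately show "g \<in> insert e (off_pair p q R - spokes y T)"
          using K(2) by (auto simp: off_pair_def in_spokes)
      qed
      then have "t + 1 \<le> 2" using target.card_off_pair_ge[OF K(1) False pq(1)] card_mono[OF fin] le2
        by (meson order_trans)
      then show False using t3 by simp
    next
      case 2
      have "{g \<in> K. y \<notin> g} \<subseteq> insert e (off_pair p q R - spokes y T)"
      proof
        fix g assume g: "g \<in> {g \<in> K. y \<notin> g}"
        then have "p \<notin> g" "q \<notin> g" using 2 pq disj by (auto simp: nsets_def)
        then show "g \<in> insert e (off_pair p q R - spokes y T)"
          using K(2) g by (auto simp: off_pair_def in_spokes)
      qed
      then have "t + 1 \<le> 2" using target.card_avoiding[OF K(1)] card_mono[OF fin] le2
        by (meson order_trans)
      then show False using t3 by simp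
    qed
  qed
qed

lemma off_pair_insert:
  assumes "finite R" "e \<notin> R"
  shows "card (off_pair p q (insert e R)) =
    (if (p \<in> e) = (q \<in> e) then Suc (card (off_pair p q R)) else card (off_pair p q R))"
proof -
  have "off_pair p q (insert e R) = (if (p \<in> e) = (q \<in> e) then insert e (off_pair p q R) else off_pair p q R)"
    by (auto simp: off_pair_def)
  moreover have "finite (off_pair p q R)" "e \<notin> off_pair p q R" using assms by (auto simp: off_pair_def)
  ultimately show ?thesis by simp
qed

lemma potential_add_VB:
  assumes "p \<in> VA" "q \<in> VA" "f \<subseteq> VB"
  shows "potential p q R (insert f B) = potential p q R B"
proof -
  have "{p, z} \<noteq> f" "{q, z} \<noteq> f" for z using assms disj by auto
  then have "open_nbrs p q R (insert f B) = open_nbrs p q R B"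
    "open_nbrs q p R (insert f B) = open_nbrs q p R B"
    by (auto simp: open_nbrs_def)
  then show ?thesis by (simp add: potential_def)
qed

text \<open>
  Moves that raise the potential to \<open>2t + 1\<close> are answered by a block at the pair, all other moves by an
  edge from \<open>y\<close> to a leaf. Hence the number of edges of the first player outside the pair stays behind
  the number of leaves in \<open>P\<close>, and these edges never suffice for a copy with other centres.
\<close>

lemma battle_with_guard:
  assumes pq: "p \<in> VA" "q \<in> VA" "p \<noteq> q"
    and pot: "potential p q R B \<le> 2 * t + 1" "card (off_pair p q R) \<le> card P"
      "potential p q R B = 2 * t + 1 \<Longrightarrow> card (off_pair p q R) < card P"
    and P: "P \<subseteq> S" "card P \<le> t" "spokes x S \<union> spokes y P \<subseteq> B"
      "\<And>l. l \<in> S \<Longrightarrow> {y, l} \<in> B \<Longrightarrow> l \<in> P"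
    and "P \<noteq> {}"
    and rm: "room k R B"
  shows "reply k R B"
  using pot P \<open>P \<noteq> {}\<close> rm
proof (induction k arbitrary: R B P rule: less_induct)
  case (less k)
  note rd = roomD[OF less.prems(9)]
  have step: "\<not> win (insert e R) \<and> reply k' (insert e R) B'"
    if pot': "potential p q R B' \<le> 2 * t" and off': "card (off_pair p q R) < card P'"
      and P': "P' \<subseteq> S" "card P' \<le> t" "spokes x S \<union> spokes y P' \<subseteq> B'"
        "\<And>l. l \<in> S \<Longrightarrow> {y, l} \<in> B' \<Longrightarrow> l \<in> P'" "P' \<noteq> {}"
      and k': "k = Suc k'" and e: "e \<in> E" "e \<notin> R" and rm': "room k' (insert e R) B'"
    for e k' B' P'
  proof
    note rd' = roomD[OF rm']
    have le: "potential p q (insert e R) B' \<le> 2 * t + 1"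
      using potential_insert_le[OF rd(4,1) pq(3), of e B'] pot' by simp
    have off: "card (off_pair p q (insert e R)) \<le> card P'"
      using off_pair_insert[OF rd(4) e(2), of p q] off' by (simp split: if_splits)
    show "\<not> win (insert e R)"
      using no_win_guarded[OF rd'(3,4,1) pq(3) le] off P'(2) by simp
    have strict: "card (off_pair p q (insert e R)) < card P'"
      if "potential p q (insert e R) B' = 2 * t + 1"
    proof -
      have "(p \<in> e) \<noteq> (q \<in> e)"
        using that pot' potential_off_pair[of p e q R B'] pq(3) by auto
      then show ?thesis using off_pair_insert[OF rd(4) e(2), of p q] off' by simp
    qed
    show "reply k' (insert e R) B'"
      by (rule less.IH[OF _ le off strict P' rm']) (use k' in simp_all)
  qed
  show ?case
  proof (cases "potential p q R B = 2 * t + 1")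
    case True
    then have "odd (potential p q R B)" by simp
    then obtain f where f: "f \<in> nsets VA 2" "f \<notin> R" "f \<notin> B" "potential p q R (insert f B) < potential p q R B"
      by (rule block_exists[OF _ rd(3,4,1) pq])
    show ?thesis
    proof (rule replyI[OF less.prems(9) _ f(2,3)])
      show "f \<in> E" using f by simp
      fix k' e assume k': "k = Suc k'" and e: "e \<in> E" "e \<notin> R" "e \<notin> insert f B"
        and rm': "room k' (insert e R) (insert f B)"
      have P4: "l \<in> P" if "l \<in> S" "{y, l} \<in> insert f B" for l
      proof -
        have "{y, l} \<noteq> f" using f(1) xy disj by (auto simp: nsets_def)
        then show ?thesis using that less.prems(7) by auto
      qed
      show "\<not> win (insert e R) \<and> reply k' (insert e R) (insert f B)"
      proof (rule step[of _ P])
        show "potential p q R (insert f B) \<le> 2 * t" using f(4) True by simp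
        show "card (off_pair p q R) < card P" by (rule less.prems(3)[OF True])
        show "spokes x S \<union> spokes y P \<subseteq> insert f B" using less.prems(6) by auto
      qed (use less.prems(4,5,8) P4 k' e rm' in simp_all)
    qed
  next
    case False
    then have pot': "potential p q R B \<le> 2 * t" using less.prems(1) by simp
    show ?thesis
    proof (cases "\<exists>l\<in>S. l \<notin> P \<and> l \<notin> taken R")
      case True
      then obtain l where l: "l \<in> S" "l \<notin> P" "l \<notin> taken R" by blast
      have fP: "finite P" using less.prems(4) finite_S finite_subset by blast
      have cP: "card (insert l P) = Suc (card P)" using l fP by simp
      have lR: "{y, l} \<notin> R" "{y, l} \<notin> B" using l less.prems(7) by auto
      have sub: "spokes x S \<union> spokes y (insert l P) \<subseteq> insert {y, l} B"
        using less.prems(6) by (auto simp: spokes_insert)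
      show ?thesis
      proof (cases "card P = t")
        case True
        have "win (insert {y, l} B)"
        proof (rule win_spokes[of x y S "insert l P"])
          show "insert {y, l} B \<subseteq> E" using rd(2) y_edge_in_E[OF l(1)] by auto
        qed (use xy S less.prems(4) l cP True sub in auto)
        then show ?thesis using lR y_edge_in_E[OF l(1)] by (intro reply_win)
      next
        case False
        show ?thesis
        proof (rule replyI[OF less.prems(9) y_edge_in_E[OF l(1)] lR])
          fix k' e assume k': "k = Suc k'" and e: "e \<in> E" "e \<notin> R" "e \<notin> insert {y, l} B"
            and rm': "room k' (insert e R) (insert {y, l} B)"
          have P4: "l' \<in> insert l P" if "l' \<in> S" "{y, l'} \<in> insert {y, l} B" for l'
            using that less.prems(7) by (auto simp: doubleton_eq_iff)
          show "\<not> win (insert e R) \<and> reply k' (insert e R) (insert {y, l} B)"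
          proof (rule step[of _ "insert l P"])
            show "potential p q R (insert {y, l} B) \<le> 2 * t"
              using potential_add_VB[OF pq(1,2), of "{y, l}"] xy l S pot' by auto
            show "card (off_pair p q R) < card (insert l P)" using cP less.prems(2) by simp
            show "card (insert l P) \<le> t" using cP less.prems(5) False by simp
          qed (use less.prems(4) l sub P4 k' e rm' in simp_all)
        qed
      qed
    next
      case False
      let ?T = "taken R"
      have dj: "?T \<inter> P = {}" using taken_disjoint[OF rd(3)] less.prems(6) by auto
      have sum: "card ?T + card P = 2 * t - 1" using False dj less.prems(4) by (intro card_leaves) auto
      have sub: "spokes y ?T \<subseteq> off_pair p q R"
      proof
        fix g assume "g \<in> spokes y ?T"
        then obtain l where "l \<in> S" "g = {y, l}" "g \<in> R" by (auto simp: in_spokes)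
        then show "g \<in> off_pair p q R" using S xy pq disj by (auto simp: off_pair_def)
      qed
      have fo: "finite (off_pair p q R)" using rd(4) by (simp add: off_pair_def)
      have "card ?T \<le> card (off_pair p q R)" by (rule card_spokes_taken_le[OF fo sub])
      then have cPt: "card P = t" "card ?T = t - 1" "card (off_pair p q R) \<le> t"
        using sum less.prems(2,5) t3 by linarith+
      have "card (off_pair p q R - spokes y ?T) = card (off_pair p q R) - card (spokes y ?T)"
        using sub fo by (intro card_Diff_subset finite_subset[OF sub])
      then have one: "card (off_pair p q R - spokes y ?T) \<le> 1"
        using cPt by (simp add: card_spokes)
      obtain l where "l \<in> P" using less.prems(8) by blast
      then have "{y, l} \<in> B" using less.prems(6) unfolding spokes_def by auto
      then have yB: "y \<in> \<Union> B" by auto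
      have "safe R B y"
        by (rule safe_guarded[OF rd(3,4,1) pq(3,1,2) pot' one yB])
      then show ?thesis
        by (rule endgame[OF _ _ less.prems(6,4) cPt(1) less.prems(9)]) simp
    qed
  qed
qed

text \<open>
  Here the first player has only blocked since he had the \<open>2t\<close> edges \<open>G1\<close>. His first other move \<open>e\<close>
  decides whether some copy contains \<open>G1\<close> and \<open>e\<close>, that is, whether a pair has to be guarded. That move
  may come as late as after all blocks; therefore the second player has to choose her leaves without
  knowing it, and \<open>fin_safe\<close> asks for a set \<open>X\<close> that is good for all \<open>e0\<close>.
\<close>

lemma battle:
  assumes G1: "G1 \<subseteq> E" "card G1 = 2 * t" "e1 \<in> G1" "e1 \<subseteq> VA" "y \<notin> \<Union> G1"
    and X: "X \<subseteq> S"
    and fin_safe: "\<And>T e0. T \<subseteq> S \<Longrightarrow> card T = t - 1 \<Longrightarrow> 2 * card (T \<inter> X) \<le> card X \<Longrightarrow>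
        e0 \<in> E \<Longrightarrow> e0 \<notin> spokes x S \<Longrightarrow> e0 \<notin> spokes y S \<Longrightarrow>
        \<exists>d\<in>{x, y}. safe (insert e0 G1 \<union> spokes y T) (spokes x S \<union> spokes y (S - T)) d"
    and R: "R = G1 \<union> spokes y T" "T \<subseteq> S" "P \<subseteq> S" "card P = card T" "card (T \<inter> X) \<le> card (P \<inter> X)"
    and rm: "room k R (spokes x S \<union> spokes y P)"
  shows "reply k R (spokes x S \<union> spokes y P)"
  using R rm
proof (induction k arbitrary: R P T rule: less_induct)
  case (less k)
  let ?B = "spokes x S \<union> spokes y P"
  note rd = roomD[OF less.prems(6)]
  have yPB: "spokes y P \<subseteq> ?B" by auto
  have yG1: "{y, l} \<notin> G1" for l using G1(5) by auto
  have T: "taken R = T" using less.prems(1,2) yG1 by auto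
  have dj: "T \<inter> P = {}" using taken_disjoint[OF rd(3) yPB] T by simp
  have fT: "finite T" "finite P" using less.prems finite_S finite_subset by blast+
  have "\<exists>l\<in>S. l \<notin> P \<and> l \<notin> T"
  proof (rule ccontr)
    assume "\<not> ?thesis"
    then have "card T + card P = 2 * t - 1"
      using dj less.prems(3) card_leaves[of P R] T by auto
    then show False using less.prems(4) t3 by presburger
  qed
  then obtain o1 where o1: "o1 \<in> S" "o1 \<notin> P" "o1 \<notin> taken R" using T by blast
  have prefTP: "card (taken R \<inter> X) \<le> card (P \<inter> X)" using less.prems(5) T by simp
  obtain l where l: "l \<in> S" "l \<notin> P" "l \<notin> taken R" and
    pref: "\<forall>e. e \<notin> R \<longrightarrow> e \<notin> insert {y, l} ?B \<longrightarrow>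
       card (taken (insert e R) \<inter> X) \<le> card (insert l P \<inter> X)"
    by (rule pick_preferred[OF X prefTP less.prems(3) yPB o1])
  have eqB: "insert {y, l} ?B = spokes x S \<union> spokes y (insert l P)" by (simp add: spokes_insert)
  have cP: "card (insert l P) = Suc (card T)" using l fT less.prems(4) by simp
  have lR: "{y, l} \<notin> R" "{y, l} \<notin> ?B" using l by auto
  have "card T + card (insert l P) \<le> card S"
  proof -
    have "card (T \<union> insert l P) \<le> card S"
      using less.prems(2,3) l finite_S by (intro card_mono) auto
    moreover have "card (T \<union> insert l P) = card T + card (insert l P)"
      using dj l fT T by (intro card_Un_disjoint) auto
    ultimately show ?thesis by simp
  qed
  then have cT: "card T \<le> t - 1" using cP S by simp
  have cR: "card R = 2 * t + card T"
  proof -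
    have "card R = card G1 + card (spokes y T)" unfolding less.prems(1)
      using rd(4) less.prems(1) yG1 by (intro card_Un_disjoint) (auto simp: in_spokes)
    then show ?thesis using G1(2) by (simp add: card_spokes)
  qed
  show ?case
  proof (rule replyI[OF less.prems(6) y_edge_in_E[OF l(1)] lR])
    fix k' e assume k': "k = Suc k'" and e: "e \<in> E" "e \<notin> R" "e \<notin> insert {y, l} ?B"
      and rm': "room k' (insert e R) (insert {y, l} ?B)"
    have rm2: "room k' (insert e R) (spokes x S \<union> spokes y (insert l P))" using rm' eqB by simp
    have lP: "insert l P \<subseteq> S" using l less.prems(3) by simp
    have cR': "card (insert e R) = Suc (2 * t + card T)" using cR e(2) rd(4) by simp
    have "\<not> win (insert e R)"
    proof
      assume "win (insert e R)"
      then obtain a b K where K: "target t a b K" "K \<subseteq> insert e R"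
        using winE roomD(1)[OF rm'] by blast
      \<comment> \<open>A copy would use up all edges, among them \<open>e1\<close> in \<open>VA\<close> and the blocks in \<open>VB\<close>.\<close>
      have "card (insert e R) \<le> card K" using target.card_K[OF K(1)] cR' cT t3 by simp
      then have Keq: "K = insert e R" using K(2) rd(4) by (intro card_seteq) auto
      then have "3 * t = Suc (2 * t + card T)" using target.card_K[OF K(1)] cR' by simp
      then have "T \<noteq> {}" using t3 by auto
      then obtain l' where "l' \<in> T" by blast
      then have "{y, l'} \<in> K" "e1 \<in> K" using Keq less.prems(1) G1(3) by auto
      moreover have "K \<subseteq> nsets VA 2 \<or> K \<subseteq> nsets VB 2"
        using copy_on_one_side[OF K(1)] roomD(1)[OF rm'] Keq by simp
      moreover have "e1 \<noteq> {}" using G1(1,3) edge_card by force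
      ultimately show False using G1(4) xy disj by (auto simp: nsets_def)
    qed
    moreover have "reply k' (insert e R) (spokes x S \<union> spokes y (insert l P))"
    proof (cases "\<exists>l'\<in>S. e = {y, l'}")
      case True
      then obtain l' where l': "l' \<in> S" "e = {y, l'}" by blast
      have "l' \<notin> T" using l' e(2) T by auto
      have tk: "taken (insert e R) = insert l' T"
        using l' T by (auto simp: doubleton_eq_iff)
      show ?thesis
      proof (rule less.IH[where T = "insert l' T"])
        show "insert e R = G1 \<union> spokes y (insert l' T)" using less.prems(1) l' by (simp add: spokes_insert)
        show "card (insert l P) = card (insert l' T)" using cP \<open>l' \<notin> T\<close> fT by simp
        show "card (insert l' T \<inter> X) \<le> card (insert l P \<inter> X)"
          using pref e tk by auto
      qed (use k' l' less.prems(2) lP rm2 in simp_all)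
    next
      case False
      have eS: "e \<notin> spokes x S" "e \<notin> spokes y S" using e(3) False by (auto simp: in_spokes)
      let ?G0 = "insert e G1"
      have G0R: "?G0 \<subseteq> insert e R" using less.prems(1) by auto
      have cG0: "card ?G0 = 2 * t + 1"
        using e(2) less.prems(1) G1(2) rd(4) by simp
      show ?thesis
      proof (cases "\<exists>a b K. target t a b K \<and> K \<subseteq> E \<and> ?G0 \<subseteq> K")
        case False
        show ?thesis
        proof (rule battle_without_guard[OF G0R cG0 _ _ X])
          show "card (taken (insert e R) \<inter> X) \<le> card (insert l P \<inter> X)" using pref e by simp
          show "card (insert e R) = 2 * t + card (insert l P)" using cR' cP by simp
          show "card (insert l P) \<le> t" using cP cT t3 by simp
          show "{y, l'} \<notin> ?G0" if "l' \<in> S" for l'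
            using yG1 \<open>\<not> (\<exists>l'\<in>S. e = {y, l'})\<close> that by auto
          show "\<exists>d\<in>{x, y}. safe (?G0 \<union> spokes y T) (spokes x S \<union> spokes y (S - T)) d"
            if "T \<subseteq> S" "card T = t - 1" "2 * card (T \<inter> X) \<le> card X" for T
            using fin_safe[OF that e(1) eS] .
        qed (use False lP rm2 in auto)
      next
        case True
        then obtain a b K where K: "target t a b K" "K \<subseteq> E" "?G0 \<subseteq> K" by blast
        interpret target t a b K by (rule K)
        have "card e1 = 2" using G1(1,3) by (intro edge_card) auto
        then have e1: "e1 \<in> K" "e1 \<noteq> {}" using K(3) G1(3) by auto
        have "K \<subseteq> nsets VA 2"
        proof -
          have "\<not> K \<subseteq> nsets VB 2" using e1 G1(4) disj by (auto simp: nsets_def)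
          then show ?thesis using copy_on_one_side[OF K(1,2)] by simp
        qed
        moreover have "edges_at K a \<noteq> {}" using card_at_a t3 by (intro notI) simp
        moreover have "edges_at K b \<noteq> {}" using card_at_b by (intro notI) simp
        ultimately have ab: "a \<in> VA" "b \<in> VA" by (auto simp: nsets_def)
        have TV: "T \<subseteq> VB" using less.prems(2) S by simp
        have off_y: "a \<notin> g" "b \<notin> g" if "g \<in> spokes y T" for g
          using that TV xy ab disj by (auto simp: in_spokes)
        have "potential a b (insert e R) (spokes x S \<union> spokes y (insert l P)) \<le> card ?G0"
        proof (rule potential_le_card[OF _ centres_neq])
          show "finite ?G0" using rd(4) less.prems(1) by simp
          show "{a, z} \<in> ?G0" if "{a, z} \<in> insert e R" for z
            using that off_y[of "{a, z}"] less.prems(1) by auto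
          show "{b, z} \<in> ?G0" if "{b, z} \<in> insert e R" for z
            using that off_y[of "{b, z}"] less.prems(1) by auto
        qed
        then have pot: "potential a b (insert e R) (spokes x S \<union> spokes y (insert l P)) \<le> 2 * t + 1"
          using cG0 by simp
        have "off_pair a b (insert e R) \<subseteq> spokes y T"
          using one_centre K(3) less.prems(1) by (auto simp: off_pair_def)
        then have "card (off_pair a b (insert e R)) \<le> card T"
          using card_mono[of "spokes y T"] fT by (simp add: card_spokes)
        then have off: "card (off_pair a b (insert e R)) < card (insert l P)" using cP by simp
        show ?thesis
        proof (rule battle_with_guard[OF ab centres_neq pot _ off lP])
          show "card (insert l P) \<le> t" using cP cT t3 by simp
          show "l' \<in> insert l P" if "l' \<in> S" "{y, l'} \<in> spokes x S \<union> spokes y (insert l P)" for l'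
            using that by simp
        qed (use off rm2 in simp_all)
      qed
    qed
    ultimately show "\<not> win (insert e R) \<and> reply k' (insert e R) (insert {y, l} ?B)"
      unfolding eqB by simp
  qed
qed

end

section \<open>Threats left to the first player after the battle\<close>

text \<open>
  A single edge makes at most one vertex a new common neighbour of \<open>p\<close> and \<open>q\<close>.
\<close>

lemma card_nbrs_of_two_edges:
  assumes "p \<noteq> q"
  shows "finite {z. z \<noteq> p \<and> z \<noteq> q \<and> ({p, z} \<in> {e0, e} \<or> {q, z} \<in> {e0, e})}"
    and "card {z. z \<noteq> p \<and> z \<noteq> q \<and> ({p, z} \<in> {e0, e} \<or> {q, z} \<in> {e0, e})} \<le> 2"
proof -
  have one: "\<exists>z0. {z. z \<noteq> p \<and> z \<noteq> q \<and> ({p, z} = g \<or> {q, z} = g)} \<subseteq> {z0}" for g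
  proof (cases "\<exists>z. z \<noteq> p \<and> z \<noteq> q \<and> ({p, z} = g \<or> {q, z} = g)")
    case True
    then obtain z where "z \<noteq> p" "z \<noteq> q" "{p, z} = g \<or> {q, z} = g" by blast
    then show ?thesis using assms by (intro exI[of _ z]) (auto simp: doubleton_eq_iff)
  next
    case False then show ?thesis by auto
  qed
  obtain z0 z1 where
    "{z. z \<noteq> p \<and> z \<noteq> q \<and> ({p, z} = e0 \<or> {q, z} = e0)} \<subseteq> {z0}"
    "{z. z \<noteq> p \<and> z \<noteq> q \<and> ({p, z} = e \<or> {q, z} = e)} \<subseteq> {z1}"
    using one by meson
  then have sub: "{z. z \<noteq> p \<and> z \<noteq> q \<and> ({p, z} \<in> {e0, e} \<or> {q, z} \<in> {e0, e})} \<subseteq> {z0, z1}"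
    by auto
  then show "finite {z. z \<noteq> p \<and> z \<noteq> q \<and> ({p, z} \<in> {e0, e} \<or> {q, z} \<in> {e0, e})}"
    by (rule finite_subset) simp
  have "card {z. z \<noteq> p \<and> z \<noteq> q \<and> ({p, z} \<in> {e0, e} \<or> {q, z} \<in> {e0, e})} \<le> card {z0, z1}"
    using sub by (intro card_mono) auto
  also have "\<dots> \<le> 2" by (simp add: card_insert_if)
  finally show "card {z. z \<noteq> p \<and> z \<noteq> q \<and> ({p, z} \<in> {e0, e} \<or> {q, z} \<in> {e0, e})} \<le> 2" .
qed

context double_star
begin

text \<open>
  In the following, \<open>M\<close> stands for the edges that the first player has in \<open>VB\<close> when \<open>y\<close> is chosen,
  \<open>e0\<close> for his only move in an unguarded battle that is not a block, \<open>T\<close> for the leaves that he blocked, and \<open>e\<close>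
  for a winning move of his in the endgame. The next two definitions are the configurations that are
  still dangerous if all edges of \<open>M\<close>, at most \<open>2t - 1\<close> in number, are put to use: the centres are two
  blocked leaves and \<open>y\<close> is a common neighbour of them, or \<open>M\<close> is a star at one centre and \<open>y\<close> is the
  other centre.
\<close>

definition splits_all :: "'a set set \<Rightarrow> 'a set \<Rightarrow> bool" where
  "splits_all M T \<longleftrightarrow> (\<exists>a b. a \<noteq> b \<and> a \<in> T \<and> b \<in> T \<and> card M = 2 * t - 1 \<and>
     (\<forall>g\<in>M. (a \<in> g) \<noteq> (b \<in> g)) \<and> (\<exists>g\<in>M. a \<in> g) \<and> (\<exists>g\<in>M. b \<in> g))"

definition star_on :: "'a set set \<Rightarrow> 'a set \<Rightarrow> bool" where
  "star_on M T \<longleftrightarrow> (\<exists>w. (\<forall>g\<in>M. w \<in> g) \<and> card M = 2 * t - 1 \<and> T \<subseteq> nbrs M w \<and> card (nbrs M w - S) \<ge> 2)"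

text \<open>
  If \<open>d\<close> is a centre of the copy, then all but two of the \<open>t + 1\<close> common neighbours come from \<open>M\<close> and
  the blocks, as \<open>e0\<close> and \<open>e\<close> contribute one each and the untouched vertices none. If \<open>d\<close> is not a
  centre, then the copy has no edges from \<open>d\<close> to \<open>F\<close>, and the \<open>3t\<close> edges can be reached only if \<open>M\<close>
  has \<open>2t - 1\<close> edges which are all used.
\<close>

lemma unsafe_copy:
  assumes K: "target t a b K" "K \<subseteq> insert e (insert e0 M \<union> spokes y T \<union> spokes d F)"
    and M: "finite M" "card M \<le> 2 * t - 1" "y \<notin> \<Union> M" "M \<inter> spokes x S = {}"
    and T: "T \<subseteq> S" "card T = t - 1"
    and e: "e \<notin> spokes y S" "e0 \<notin> spokes y S"
    and F: "F \<inter> \<Union> M = {}" "F \<inter> e0 = {}" "F \<inter> S = {}" "x \<notin> F" "y \<notin> F" and d: "d \<in> {x, y}"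
  shows "splits_all M T \<or> (d = y \<and> (\<exists>w. card (T \<inter> nbrs M w) \<ge> t - 1)) \<or>
     (d = x \<and> ((\<exists>w. w \<noteq> x \<and> card (nbrs M x \<inter> nbrs M w) \<ge> t - 1) \<or> star_on M T))"
proof -
  interpret tg: target t a b K by (rule K)
  note finT = finite_subset[OF T(1) finite_S]
  have Kcases: "g = e \<or> g = e0 \<or> g \<in> M \<or> g \<in> spokes y T \<or> g \<in> spokes d F" if "g \<in> K" for g
    using K(2) that by auto
  \<comment> \<open>Vertices in \<open>F\<close> have degree at most two and are no centres.\<close>
  have Fc: "v \<notin> {a, b}" if "v \<in> F" for v
  proof
    assume v: "v \<in> {a, b}"
    have "edges_at K v \<subseteq> {{d, v}, e}"
    proof
      fix g assume g: "g \<in> edges_at K v"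
      have "g \<notin> M" "g \<noteq> e0" using g F(1,2) that by auto
      moreover have "g \<notin> spokes y T" using g F(3,5) T(1) that by (auto simp: in_spokes)
      moreover have "g = {d, v}" if "g \<in> spokes d F" using that g F(4,5) d \<open>v \<in> F\<close> by (auto simp: in_spokes)
      ultimately show "g \<in> {{d, v}, e}" using Kcases[of g] g by auto
    qed
    then have "card (edges_at K v) \<le> card {{d, v}, e}" by (intro card_mono) auto
    also have "\<dots> \<le> 2" by (simp add: card_insert_if)
    finally show False using tg.card_at_centre[OF v] t3 by simp
  qed
  show ?thesis
  proof (cases "d \<in> {a, b}")
    case True
    obtain w where w: "w \<in> {a, b}" "w \<noteq> d" using True tg.centres_neq by auto
    let ?Z = "nbrs K d \<inter> nbrs K w"
    let ?N = "{z. z \<noteq> d \<and> z \<noteq> w \<and> ({d, z} \<in> {e0, e} \<or> {w, z} \<in> {e0, e})}"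
    have Z: "card ?Z = t + 1" using tg.common_nbrs[OF True w(1)] w(2) by simp
    have ne: "z \<noteq> d" "z \<noteq> w" if "z \<in> ?Z" for z
      using that tg.one_centre[of "{d, z}"] tg.one_centre[of "{w, z}"] True w by auto
    note N = card_nbrs_of_two_edges[OF w(2)[symmetric], of e0 e]
    have bound: "t - 1 \<le> card Q" if sub: "?Z \<subseteq> Q \<union> ?N" and "finite Q" for Q
    proof -
      have "t + 1 \<le> card (Q \<union> ?N)" using Z card_mono[OF _ sub] N(1) that(2) by simp
      also have "\<dots> \<le> card Q + card ?N" by (rule card_Un_le)
      finally show ?thesis using N(2) by simp
    qed
    show ?thesis
    proof (cases "d = y")
      case dy: True
      have "?Z \<subseteq> (T \<inter> nbrs M w) \<union> ?N"
      proof
        fix z assume z: "z \<in> ?Z"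
        note zne = ne[OF z]
        show "z \<in> (T \<inter> nbrs M w) \<union> ?N"
        proof (cases "z \<in> ?N")
          case False
          then have n: "{y, z} \<notin> {e0, e}" "{w, z} \<notin> {e0, e}" using zne dy by auto
          have "{y, z} \<notin> M" using M(3) by auto
          then have 1: "z \<in> T \<or> z \<in> F" using Kcases[of "{y, z}"] z n dy by auto
          have "{w, z} \<notin> spokes y A" for A
            using w(2) zne dy by (auto simp: in_spokes doubleton_eq_iff)
          then have 2: "{w, z} \<in> M" using Kcases[of "{w, z}"] z n dy by auto
          then have "z \<notin> F" using F(1) by auto
          then show ?thesis using 1 2 by auto
        qed simp
      qed
      then have "t - 1 \<le> card (T \<inter> nbrs M w)" using finT by (intro bound) auto
      then show ?thesis using dy by blast
    next
      case False
      then have dx: "d = x" using d by simp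
      have "?Z \<subseteq> (nbrs M x \<inter> nbrs M w) \<union> ?N"
      proof
        fix z assume z: "z \<in> ?Z"
        note zne = ne[OF z]
        show "z \<in> (nbrs M x \<inter> nbrs M w) \<union> ?N"
        proof (cases "z \<in> ?N")
          case False
          then have n: "{x, z} \<notin> {e0, e}" "{w, z} \<notin> {e0, e}" using zne dx by auto
          have xT: "{x, z} \<notin> spokes y T"
            using xy S(3) T(1) by (auto simp: in_spokes doubleton_eq_iff)
          have wF: "{w, z} \<notin> spokes x F"
            using w(2) zne dx by (auto simp: in_spokes doubleton_eq_iff)
          have wMT: "{w, z} \<in> M \<or> {w, z} \<in> spokes y T" using Kcases[of "{w, z}"] z n dx wF by auto
          have "z \<notin> F"
          proof
            assume zF: "z \<in> F"
            then have "{w, z} \<notin> M" using F(1) by auto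
            moreover have "{w, z} \<notin> spokes y T"
              using zF F(3,5) T(1) by (auto simp: in_spokes doubleton_eq_iff)
            ultimately show False using wMT by simp
          qed
          then have xM: "{x, z} \<in> M" using Kcases[of "{x, z}"] z n dx xT by auto
          have "{w, z} \<notin> spokes y T"
          proof
            assume "{w, z} \<in> spokes y T"
            then consider "z \<in> T" | "z = y" by (auto simp: in_spokes doubleton_eq_iff)
            then show False
            proof cases
              case 1
              then have "{x, z} \<in> spokes x S" using T(1) by auto
              then show False using xM M(4) by auto
            next
              case 2 then show False using xM M(3) by auto
            qed
          qed
          then show ?thesis using xM wMT by auto
        qed simp
      qed
      moreover have "finite (nbrs M x \<inter> nbrs M w)"
      proof -
        have "finite (spokes x (nbrs M x \<inter> nbrs M w))"
          using M(1) by (rule rev_finite_subset) (auto simp: in_spokes)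
        then show ?thesis
          unfolding spokes_def by (rule finite_imageD) (auto simp: inj_on_def doubleton_eq_iff)
      qed
      ultimately have "t - 1 \<le> card (nbrs M x \<inter> nbrs M w)" by (rule bound)
      then show ?thesis using dx w(2) by blast
    qed
  next
    case False
    have noF: "g \<notin> spokes d F" if "g \<in> K" for g
    proof
      assume "g \<in> spokes d F"
      then obtain v where "v \<in> F" "g = {d, v}" by (auto simp: in_spokes)
      then show False using tg.one_centre[OF that] False Fc[of v] by auto
    qed
    have Ksub: "K \<subseteq> (K \<inter> M) \<union> (K \<inter> spokes y T) \<union> {e0, e}"
      using Kcases noF by auto
    have count: "3 * t \<le> card (K \<inter> M) + card (K \<inter> spokes y T) + 2"
    proof -
      have "3 * t \<le> card ((K \<inter> M) \<union> (K \<inter> spokes y T) \<union> {e0, e})"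
        using card_mono[OF _ Ksub] tg.card_K M(1) finT by simp
      also have "\<dots> \<le> card ((K \<inter> M) \<union> (K \<inter> spokes y T)) + card {e0, e}" by (rule card_Un_le)
      also have "card ((K \<inter> M) \<union> (K \<inter> spokes y T)) \<le> card (K \<inter> M) + card (K \<inter> spokes y T)"
        by (rule card_Un_le)
      also have "card {e0, e} \<le> 2" by (simp add: card_insert_if)
      finally show ?thesis by simp
    qed
    have KM: "card (K \<inter> M) \<le> card M" using M(1) by (intro card_mono) auto
    have full: "M \<subseteq> K" "card M = 2 * t - 1" if "card (K \<inter> M) \<ge> 2 * t - 1"
    proof -
      have "K \<inter> M = M" using that M KM by (intro card_seteq) auto
      then show "M \<subseteq> K" by auto
      show "card M = 2 * t - 1" using that M(2) KM by simp
    qed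
    show ?thesis
    proof (cases "y \<in> {a, b}")
      case yc: False
      have "K \<inter> spokes y T \<subseteq> spokes y (T \<inter> {a, b})"
      proof
        fix g assume g: "g \<in> K \<inter> spokes y T"
        then obtain z where z: "z \<in> T" "g = {y, z}" by (auto simp: in_spokes)
        then have "z \<in> {a, b}" using tg.one_centre[of g] g yc by auto
        then show "g \<in> spokes y (T \<inter> {a, b})" using z by simp
      qed
      then have "card (K \<inter> spokes y T) \<le> card (T \<inter> {a, b})"
        using card_mono[of "spokes y (T \<inter> {a, b})"] by (simp add: card_spokes)
      then have le: "3 * t \<le> card (K \<inter> M) + card (T \<inter> {a, b}) + 2" using count by simp
      have two: "card (T \<inter> {a, b}) \<le> card {a, b}" by (intro card_mono) auto
      have cab: "card {a, b} = 2" using tg.centres_neq by simp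
      have le2: "card (T \<inter> {a, b}) \<le> t - 1"
        using card_mono[of T "T \<inter> {a, b}"] finT T(2) by simp
      \<comment> \<open>A vertex \<open>y\<close> that is not a centre has edges to centres only, so at most two blocks are used.\<close>
      have t_eq: "t = 3" "card (T \<inter> {a, b}) = 2" "card (K \<inter> M) \<ge> 2 * t - 1"
        using le two cab le2 KM M(2) t3 by linarith+
      have "T \<inter> {a, b} = {a, b}" using t_eq(2) cab by (intro card_seteq) auto
      then have abT: "a \<in> T" "b \<in> T" by auto
      have ex: "\<exists>g\<in>M. c \<in> g" if c: "c \<in> {a, b}" for c
      proof (rule ccontr)
        assume no: "\<not> (\<exists>g\<in>M. c \<in> g)"
        have "c \<noteq> y" using c yc by auto
        have "edges_at K c \<subseteq> {e0, e, {y, c}}"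
        proof
          fix g assume g: "g \<in> edges_at K c"
          have "g = {y, c}" if "g \<in> spokes y T" using that g \<open>c \<noteq> y\<close> by (auto simp: in_spokes)
          then show "g \<in> {e0, e, {y, c}}" using g no Kcases[of g] noF[of g] by auto
        qed
        then have "card (edges_at K c) \<le> card {e0, e, {y, c}}" by (intro card_mono) auto
        also have "\<dots> \<le> 3" by (simp add: card_insert_if)
        finally show False using tg.card_at_centre[OF c] t_eq(1) by simp
      qed
      have "splits_all M T"
        unfolding splits_all_def using tg.centres_neq abT full[OF t_eq(3)] tg.one_centre ex
        by (intro exI[of _ a] exI[of _ b]) auto
      then show ?thesis ..
    next
      case True
      then have dx: "d = x" using False d by auto
      have "card (K \<inter> spokes y T) \<le> card (spokes y T)" using finT by (intro card_mono) auto
      then have KM2: "card (K \<inter> M) \<ge> 2 * t - 1" using count T(2) t3 by (simp add: card_spokes)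
      note MK = full[OF KM2]
      obtain w where w: "{a, b} = {w, y}" "w \<noteq> y" using True tg.centres_neq by auto
      have Mw: "w \<in> g" if "g \<in> M" for g
        using tg.one_centre[of g] that MK(1) M(3) w by (auto simp: doubleton_eq_iff)
      have "M \<subseteq> edges_at K w" using Mw MK(1) by auto
      then have cw: "2 * t - 1 \<le> card (edges_at K w)"
        using card_mono[of "edges_at K w" M] tg.finite_K MK(2) by simp
      have "w \<noteq> b" using cw tg.card_at_b t3 by auto
      then have ab: "a = w" "b = y" using w by (auto simp: doubleton_eq_iff)
      have Meq: "M = edges_at K w"
        using \<open>M \<subseteq> edges_at K w\<close> tg.finite_K tg.card_at_a MK(2) ab
        by (intro card_seteq) auto
      have nb: "nbrs K y \<subseteq> nbrs M w" using tg.nbrs_b_subset ab Meq by auto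
      let ?Q = "nbrs K y - T"
      have Q: "{y, z} \<in> {e0, e}" if "z \<in> ?Q" for z
      proof -
        have "{y, z} \<notin> M" using M(3) by auto
        then show ?thesis using that Kcases[of "{y, z}"] noF[of "{y, z}"] by auto
      qed
      have QS: "?Q \<inter> S = {}" using Q e by (auto simp: in_spokes)
      have cQ: "card ?Q \<le> 2"
      proof -
        have "card ?Q = card (spokes y ?Q)" by (simp add: card_spokes)
        moreover have "spokes y ?Q \<subseteq> {e0, e}"
        proof
          fix g assume "g \<in> spokes y ?Q"
          then obtain z where z: "z \<in> ?Q" "g = {y, z}" unfolding in_spokes by blast
          then show "g \<in> {e0, e}" using Q[OF z(1)] by simp
        qed
        then have "card (spokes y ?Q) \<le> card {e0, e}" by (intro card_mono) auto
        moreover have "card {e0, e} \<le> 2" by (simp add: card_insert_if)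
        ultimately show ?thesis by simp
      qed
      have fy: "finite (nbrs K y)" by (rule tg.finite_nbrs)
      have "card (nbrs K y) = card (nbrs K y \<inter> T) + card ?Q"
        using card_Int_Diff[OF fy] by simp
      moreover have "card (nbrs K y) = t + 1" using tg.card_nbrs_b ab by simp
      moreover have "card (nbrs K y \<inter> T) \<le> card T" using finT by (intro card_mono) auto
      ultimately have c: "card (nbrs K y \<inter> T) = card T" "card ?Q = 2" using cQ T(2) t3 by linarith+
      have "nbrs K y \<inter> T = T" using c(1) finT by (intro card_seteq) auto
      then have TN: "T \<subseteq> nbrs M w" using nb by auto
      have "?Q \<subseteq> nbrs M w - S" using nb QS by auto
      moreover have "finite (nbrs M w - S)" using tg.finite_nbrs[of w] Meq
        by (auto intro: rev_finite_subset)
      ultimately have "2 \<le> card (nbrs M w - S)" using c(2) card_mono by metis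
      then have "star_on M T" unfolding star_on_def using Mw MK(2) TN by blast
      then show ?thesis using dx by simp
    qed
  qed
qed

lemma finite_nbrs_of: "finite M \<Longrightarrow> finite (nbrs M w)" and card_nbrs_le: "finite M \<Longrightarrow> card (nbrs M w) \<le> card M"
proof -
  assume M: "finite M"
  have sub: "spokes w (nbrs M w) \<subseteq> M" by (auto simp: in_spokes)
  show "finite (nbrs M w)"
    using finite_subset[OF sub M] unfolding spokes_def
    by (rule finite_imageD) (auto simp: inj_on_def doubleton_eq_iff)
  show "card (nbrs M w) \<le> card M" using card_mono[OF M sub] by (simp add: card_spokes)
qed

text \<open>
  If \<open>M\<close> is a star with \<open>2t - 1\<close> edges and centre \<open>w\<close>, then its leaves in \<open>S\<close> are preferred. As soon
  as \<open>M\<close> has two edges from \<open>w\<close> to the outside of \<open>S\<close>, there are at most \<open>2t - 3\<close> of them, and the first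
  player gets fewer than \<open>t - 1\<close>. So \<open>d = x\<close> works. Otherwise it suffices to take away a leaf \<open>l1\<close> of maximal
  \<open>M\<close>-degree. If \<open>d = x\<close> is bad then, some \<open>v\<close> has \<open>t - 1\<close> common neighbours with \<open>x\<close> in \<open>M\<close>; this
  accounts for all edges of \<open>M\<close> but one, so that besides \<open>v\<close> hardly any leaf is touched by \<open>M\<close>, and
  \<open>d = y\<close> works.
\<close>

lemma preference_exists:
  assumes M: "finite M" "card M \<le> 2 * t - 1" "\<And>g. g \<in> M \<Longrightarrow> card g = 2" "M \<inter> spokes x S = {}"
  obtains X where "X \<subseteq> S"
    "\<And>T. T \<subseteq> S \<Longrightarrow> card T = t - 1 \<Longrightarrow> 2 * card (T \<inter> X) \<le> card X \<Longrightarrow>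
       \<not> splits_all M T \<and>
       ((\<forall>w. card (T \<inter> nbrs M w) < t - 1) \<or>
        (\<forall>w. w \<noteq> x \<longrightarrow> card (nbrs M x \<inter> nbrs M w) < t - 1) \<and> \<not> star_on M T)"
proof (cases "\<exists>w. card M = 2 * t - 1 \<and> (\<forall>g\<in>M. w \<in> g)")
  case True
  then obtain w where w: "card M = 2 * t - 1" "\<And>g. g \<in> M \<Longrightarrow> w \<in> g" by blast
  have g2: "g = {p, q}" if "g \<in> M" "p \<in> g" "q \<in> g" "p \<noteq> q" for g p q
  proof -
    have "card {p, q} = card g" using M(3) that by simp
    moreover have "finite g" using M(3)[OF that(1)] by (metis card.infinite zero_neq_numeral)
    ultimately show ?thesis using that card_subset_eq[of g "{p, q}"] by auto
  qed
  have small: False if "M \<subseteq> {g1, g2}" for g1 g2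
  proof -
    have "card M \<le> card {g1, g2}" using that by (intro card_mono) auto
    also have "\<dots> \<le> 2" by (simp add: card_insert_if)
    finally show False using w(1) t3 by simp
  qed
  show thesis
  proof (rule that[of "nbrs M w \<inter> S"])
    fix T assume T: "T \<subseteq> S" "card T = t - 1" "2 * card (T \<inter> (nbrs M w \<inter> S)) \<le> card (nbrs M w \<inter> S)"
    have 1: "\<not> splits_all M T"
    proof
      assume "splits_all M T"
      then obtain a b where ab: "a \<noteq> b" "\<forall>g\<in>M. (a \<in> g) \<noteq> (b \<in> g)" "\<exists>g\<in>M. a \<in> g" "\<exists>g\<in>M. b \<in> g"
        unfolding splits_all_def by blast
      then have "w \<noteq> a" "w \<noteq> b" using w(2) by blast+
      have "M \<subseteq> {{w, a}, {w, b}}"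
      proof
        fix g assume g: "g \<in> M"
        then have "a \<in> g \<or> b \<in> g" using ab(2) by auto
        then show "g \<in> {{w, a}, {w, b}}"
          using g2[OF g w(2)[OF g], of a] g2[OF g w(2)[OF g], of b] \<open>w \<noteq> a\<close> \<open>w \<noteq> b\<close> by auto
      qed
      then show False by (rule small)
    qed
    have 2: "card (nbrs M x \<inter> nbrs M v) < t - 1" if "v \<noteq> x" for v
    proof -
      have "nbrs M x \<inter> nbrs M v \<subseteq> {w}"
      proof
        fix z assume "z \<in> nbrs M x \<inter> nbrs M v"
        then have "w \<in> {x, z}" "w \<in> {v, z}" using w(2) by auto
        then show "z \<in> {w}" using that by auto
      qed
      then have "card (nbrs M x \<inter> nbrs M v) \<le> 1" using card_mono[of "{w}"] by auto
      then show ?thesis using t3 by simp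
    qed
    have 3: "\<not> star_on M T"
    proof
      assume "star_on M T"
      then obtain v where v: "\<forall>g\<in>M. v \<in> g" "T \<subseteq> nbrs M v" "card (nbrs M v - S) \<ge> 2"
        unfolding star_on_def by blast
      have "v = w"
      proof (rule ccontr)
        assume "v \<noteq> w"
        then have "M \<subseteq> {{v, w}, {v, w}}" using v(1) w(2) g2[of _ v w] by auto
        then show False by (rule small)
      qed
      then have "T \<inter> (nbrs M w \<inter> S) = T" using v(2) T(1) by auto
      then have "2 * (t - 1) \<le> card (nbrs M w \<inter> S)" using T by simp
      moreover have "card (nbrs M w) = card (nbrs M w \<inter> S) + card (nbrs M w - S)"
        using card_Int_Diff[OF finite_nbrs_of[OF M(1)]] by simp
      moreover have "card (nbrs M w) \<le> 2 * t - 1" using card_nbrs_le[OF M(1), of w] M(2) by simp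
      ultimately show False using v(3) \<open>v = w\<close> t3 by simp
    qed
    show "\<not> splits_all M T \<and> ((\<forall>w. card (T \<inter> nbrs M w) < t - 1) \<or>
        (\<forall>w. w \<noteq> x \<longrightarrow> card (nbrs M x \<inter> nbrs M w) < t - 1) \<and> \<not> star_on M T)"
      using 1 2 3 by simp
  qed simp
next
  case False
  have "S \<noteq> {}" using S t3 by auto
  then obtain l1 where l1: "l1 \<in> S" "\<And>l. l \<in> S \<Longrightarrow> card (edges_at M l) \<le> card (edges_at M l1)"
  proof -
    obtain l1 where "l1 \<in> S" "Max ((\<lambda>l. card (edges_at M l)) ` S) = card (edges_at M l1)"
      using obtains_MAX[OF finite_S \<open>S \<noteq> {}\<close>, of "\<lambda>l. card (edges_at M l)"] by metis
    then show ?thesis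
      using that[of l1] Max_ge[of "(\<lambda>l. card (edges_at M l)) ` S"] finite_S by simp
  qed
  show thesis
  proof (rule that[of "{l1}"])
    show "{l1} \<subseteq> S" using l1 by simp
    fix T assume T: "T \<subseteq> S" "card T = t - 1" "2 * card (T \<inter> {l1}) \<le> card {l1}"
    \<comment> \<open>The inequality for \<open>X = {l1}\<close> says that the first player did not get \<open>l1\<close>.\<close>
    have lT: "l1 \<notin> T" using T(3) by (cases "l1 \<in> T") auto
    have 1: "\<not> splits_all M T"
    proof
      assume "splits_all M T"
      then obtain a b where ab: "a \<noteq> b" "a \<in> T" "b \<in> T" "card M = 2 * t - 1" "\<forall>g\<in>M. (a \<in> g) \<noteq> (b \<in> g)"
        unfolding splits_all_def by blast
      have "M = edges_at M a \<union> edges_at M b" using ab(5) by auto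
      then have "2 * t - 1 \<le> card (edges_at M a) + card (edges_at M b)"
        using ab(4) card_Un_le[of "edges_at M a" "edges_at M b"] by simp
      then have big: "t \<le> card (edges_at M l1)"
      proof -
        have "card (edges_at M a) \<le> card (edges_at M l1)" "card (edges_at M b) \<le> card (edges_at M l1)"
          using ab(2,3) T(1) by (auto intro!: l1(2))
        with \<open>2 * t - 1 \<le> _\<close> show ?thesis by linarith
      qed
      have "edges_at M l1 \<subseteq> {{l1, a}, {l1, b}}"
      proof
        fix g assume g: "g \<in> edges_at M l1"
        obtain p q where pq: "g = {p, q}" using g M(3)[of g] by (auto simp: card_2_iff)
        have "l1 \<noteq> a" "l1 \<noteq> b" using ab(2,3) lT by auto
        moreover have "l1 \<in> g" "a \<in> g \<or> b \<in> g" using g ab(5) by blast+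
        then have "l1 \<in> {p, q}" "a \<in> {p, q} \<or> b \<in> {p, q}" unfolding pq .
        ultimately show "g \<in> {{l1, a}, {l1, b}}" unfolding pq by auto
      qed
      then have "card (edges_at M l1) \<le> card {{l1, a}, {l1, b}}" by (intro card_mono) auto
      also have "\<dots> \<le> 2" by (simp add: card_insert_if)
      finally show False using big t3 by simp
    qed
    have 3: "\<not> star_on M T" using False unfolding star_on_def by blast
    have 2: "\<forall>w. card (T \<inter> nbrs M w) < t - 1" if v: "v \<noteq> x" "card (nbrs M x \<inter> nbrs M v) \<ge> t - 1" for v
    proof -
      let ?Z = "nbrs M x \<inter> nbrs M v"
      let ?M' = "M - (spokes x ?Z \<union> spokes v ?Z)"
      have xvZ: "x \<notin> ?Z" "v \<notin> ?Z" using M(3)[of "{x}"] M(3)[of "{v}"] by auto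
      have ZS: "?Z \<inter> S = {}" using M(4) by auto
      have fZ: "finite ?Z" using finite_nbrs_of[OF M(1)] by simp
      have "card (spokes x ?Z \<union> spokes v ?Z) = card ?Z + card ?Z"
        using v(1) xvZ fZ by (subst card_Un_disjoint) (auto simp: card_spokes in_spokes doubleton_eq_iff)
      moreover have "spokes x ?Z \<union> spokes v ?Z \<subseteq> M" by (auto simp: in_spokes)
      ultimately have c1: "card ?M' \<le> 1"
        using v(2) M(2) card_Diff_subset[of "spokes x ?Z \<union> spokes v ?Z" M] fZ by simp
      have f1: "finite ?M'" using M(1) by simp
      have inM': "g \<in> ?M'" if "g \<in> M" "l \<in> g" "l \<in> S" "l \<noteq> v" for g l
        using that ZS S(3) by (auto simp: in_spokes)
      have vT: "v \<notin> T"
      proof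
        assume vT: "v \<in> T"
        have "spokes v ?Z \<subseteq> edges_at M v" by (auto simp: in_spokes)
        then have "card ?Z \<le> card (edges_at M v)"
          using card_mono[of "edges_at M v" "spokes v ?Z"] M(1) by (simp add: card_spokes)
        also have "\<dots> \<le> card (edges_at M l1)" using vT T(1) by (intro l1(2)) auto
        also have "\<dots> \<le> card ?M'"
          using inM'[of _ l1] l1(1) vT lT f1 by (intro card_mono) auto
        finally show False using c1 v(2) t3 by simp
      qed
      have "card (T \<inter> nbrs M w) < t - 1" for w
      proof -
        have "spokes w (T \<inter> nbrs M w) \<subseteq> ?M'"
        proof
          fix g assume "g \<in> spokes w (T \<inter> nbrs M w)"
          then obtain l where "l \<in> T" "g = {w, l}" "g \<in> M" by (auto simp: in_spokes)
          then show "g \<in> ?M'" using inM'[of g l] T(1) vT by auto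
        qed
        then have "card (spokes w (T \<inter> nbrs M w)) \<le> card ?M'" by (rule card_mono[OF f1])
        then have "card (T \<inter> nbrs M w) \<le> 1" using c1 by (simp only: card_spokes)
        then show ?thesis using t3 by simp
      qed
      then show ?thesis ..
    qed
    show "\<not> splits_all M T \<and> ((\<forall>w. card (T \<inter> nbrs M w) < t - 1) \<or>
        (\<forall>w. w \<noteq> x \<longrightarrow> card (nbrs M x \<inter> nbrs M w) < t - 1) \<and> \<not> star_on M T)"
      using 1 2 3 by (meson not_less)
  qed
qed

lemma preference_ends_safely:
  assumes G1: "G1 \<subseteq> E" "card G1 = 2 * t" "e1 \<in> G1" "e1 \<subseteq> VA" "y \<notin> \<Union> G1" "G1 \<inter> spokes x S = {}"
  obtains X where "X \<subseteq> S"
    "\<And>T e0. T \<subseteq> S \<Longrightarrow> card T = t - 1 \<Longrightarrow> 2 * card (T \<inter> X) \<le> card X \<Longrightarrow>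
       e0 \<in> E \<Longrightarrow> e0 \<notin> spokes x S \<Longrightarrow> e0 \<notin> spokes y S \<Longrightarrow>
       \<exists>d\<in>{x, y}. safe (insert e0 G1 \<union> spokes y T) (spokes x S \<union> spokes y (S - T)) d"
proof -
  define M where "M = G1 \<inter> nsets VB 2"
  have fG: "finite G1" using G1(1) finite_E finite_subset by blast
  have fM: "finite M" using fG by (simp add: M_def)
  have "card e1 = 2" using G1(1,3) by (intro edge_card) auto
  then have "e1 \<noteq> {}" by auto
  then have "\<not> e1 \<subseteq> VB" using G1(4) disj by blast
  then have "e1 \<notin> M" by (auto simp: M_def nsets_def)
  then have "M \<subseteq> G1 - {e1}" by (auto simp: M_def)
  then have "card M \<le> card (G1 - {e1})" using fG by (intro card_mono) auto
  then have cM: "card M \<le> 2 * t - 1" using fG G1(2,3) by simp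
  have M2: "card g = 2" if "g \<in> M" for g using that by (simp add: M_def nsets_def)
  have MS: "M \<inter> spokes x S = {}" using G1(6) by (auto simp: M_def)
  have yM: "y \<notin> \<Union> M" using G1(5) by (auto simp: M_def)
  obtain X where X: "X \<subseteq> S" and
    good: "\<And>T. T \<subseteq> S \<Longrightarrow> card T = t - 1 \<Longrightarrow> 2 * card (T \<inter> X) \<le> card X \<Longrightarrow>
       \<not> splits_all M T \<and>
       ((\<forall>w. card (T \<inter> nbrs M w) < t - 1) \<or>
        (\<forall>w. w \<noteq> x \<longrightarrow> card (nbrs M x \<inter> nbrs M w) < t - 1) \<and> \<not> star_on M T)"
    by (rule preference_exists[OF fM cM M2 MS]) blast+
  show thesis
  proof (rule that[OF X])
    fix T e0 assume T: "T \<subseteq> S" "card T = t - 1" "2 * card (T \<inter> X) \<le> card X"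
      and e0: "e0 \<in> E" "e0 \<notin> spokes x S" "e0 \<notin> spokes y S"
    let ?R = "insert e0 G1 \<union> spokes y T" and ?B = "spokes x S \<union> spokes y (S - T)"
    define d where "d = (if \<forall>w. card (T \<inter> nbrs M w) < t - 1 then y else x)"
    have d: "d \<in> {x, y}" by (simp add: d_def)
    have no: "\<not> splits_all M T" "d = y \<Longrightarrow> \<not> (\<exists>w. card (T \<inter> nbrs M w) \<ge> t - 1)"
      "d = x \<Longrightarrow> \<not> ((\<exists>w. w \<noteq> x \<and> card (nbrs M x \<inter> nbrs M w) \<ge> t - 1) \<or> star_on M T)"
      using good[OF T] xy(3) by (auto simp: d_def not_le split: if_splits)
    have "T \<noteq> S" using T(2) S(2) t3 by auto
    then obtain s where s: "s \<in> S" "s \<notin> T" using T(1) by blast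
    have in_B: "x \<in> \<Union> ?B" "y \<in> \<Union> ?B" "S \<subseteq> \<Union> ?B"
    proof -
      have "{x, s} \<in> ?B" "{y, s} \<in> ?B" using s by simp_all
      then show "x \<in> \<Union> ?B" "y \<in> \<Union> ?B" by blast+
      have "{x, l} \<in> ?B" if "l \<in> S" for l using that by simp
      then show "S \<subseteq> \<Union> ?B" by blast
    qed
    have "safe ?R ?B d"
      unfolding safe_def
    proof (intro allI impI notI)
      fix F e assume F: "finite F" "F \<subseteq> VB" "F \<inter> \<Union> (?R \<union> ?B) = {}"
        and e: "e \<in> E" "e \<notin> ?R" "e \<notin> ?B" and win: "win (insert e (?R \<union> spokes d F))"
      let ?U = "insert e (?R \<union> spokes d F)"
      have FxyS: "x \<notin> F" "y \<notin> F" "F \<inter> S = {}" using F(3) in_B by blast+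
      have FM: "F \<inter> \<Union> M = {}" "F \<inter> e0 = {}" using F(3) unfolding M_def by blast+
      have in_VB: "spokes c A \<subseteq> nsets VB 2" if "c \<in> VB" "A \<subseteq> VB" "c \<notin> A" for c A
        using that by (auto simp: in_spokes subset_iff)
      have dF: "spokes d F \<subseteq> nsets VB 2" using F(2) FxyS d xy by (intro in_VB) auto
      have yT: "spokes y T \<subseteq> nsets VB 2" using T(1) S xy by (intro in_VB) auto
      have "?U \<subseteq> E" using e(1) e0(1) G1(1) dF yT by auto
      then obtain a b K where K: "target t a b K" "K \<subseteq> ?U" "K \<subseteq> E"
        using winE[OF win] by (metis order_trans)
      have eS: "e \<notin> spokes y S"
      proof
        assume "e \<in> spokes y S"
        then obtain l where "l \<in> S" "e = {y, l}" unfolding in_spokes by blast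
        then show False using e(2,3) by (cases "l \<in> T") simp_all
      qed
      from copy_on_one_side[OF K(1,3)] show False
      proof
        assume KA: "K \<subseteq> nsets VA 2"
        have "nsets VA 2 \<inter> nsets VB 2 = {}"
        proof -
          have False if "g \<subseteq> VA" "g \<subseteq> VB" "card g = 2" for g
          proof -
            have "g = {}" using that disj by blast
            then show False using that(3) by simp
          qed
          then show ?thesis unfolding nsets_def by blast
        qed
        then have "K \<subseteq> insert e (insert e0 G1)" using K(2) KA dF yT by blast
        then have "card K \<le> card (insert e (insert e0 G1))" using fG by (intro card_mono) auto
        also have "\<dots> \<le> Suc (Suc (card G1))" using fG by (simp add: card_insert_if)
        finally show False using target.card_K[OF K(1)] G1(2) t3 by simp
      next
        assume KB: "K \<subseteq> nsets VB 2"
        have "K \<subseteq> insert e (insert e0 M \<union> spokes y T \<union> spokes d F)"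
          using K(2) KB unfolding M_def by blast
        from unsafe_copy[OF K(1) this fM cM yM MS T(1,2) eS e0(3) FM FxyS(3,1,2) d]
        show False using no by blast
      qed
    qed
    then show "\<exists>d\<in>{x, y}. safe ?R ?B d" using d by blast
  qed
qed

end

section \<open>The opening\<close>

context board
begin

text \<open>
  No edge of the star has to be defended, since its leaves are arbitrary; meanwhile the first player has
  at most \<open>2t\<close> edges and cannot have won.
\<close>

lemma star_opening:
  assumes x: "x \<in> VB" "x \<notin> S" and S: "S \<subseteq> VB" "card S \<le> 2 * t - 1"
    and e1: "e1 \<in> R" "e1 \<subseteq> VA" and R: "card R = Suc (card S)" and rm: "room k R (spokes x S)"
  shows "reply k R (spokes x S)"
  using x(2) S e1(1) R rm
proof (induction k arbitrary: R S rule: less_induct)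
  case (less k)
  note rd = roomD[OF less.prems(6)]
  have fS: "finite S" using less.prems(2) fin finite_subset by blast
  obtain v where v: "v \<in> VB" "v \<notin> \<Union> (R \<union> spokes x S)" "v \<notin> {x}"
    by (rule fresh_vertex[OF less.prems(6), of "{x}"]) auto
  have "v \<notin> {x, l}" if "l \<in> S" for l
  proof -
    have "{x, l} \<in> R \<union> spokes x S" using that by simp
    then show ?thesis using v(2) by blast
  qed
  then have vS: "v \<notin> S" by blast
  show ?case
  proof (cases "card S = 2 * t - 1")
    case True
    interpret ds: double_star VA VB n t win x v S
      using x(1) less.prems v vS True by unfold_locales auto
    have R2: "card R = 2 * t" using less.prems(5) True t3 by simp
    have vR: "v \<notin> \<Union> R" using v(2) by auto
    obtain X where X: "X \<subseteq> S" and safe: "\<And>T e0. T \<subseteq> S \<Longrightarrow> card T = t - 1 \<Longrightarrow> 2 * card (T \<inter> X) \<le> card X \<Longrightarrow>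
       e0 \<in> E \<Longrightarrow> e0 \<notin> spokes x S \<Longrightarrow> e0 \<notin> spokes v S \<Longrightarrow>
       \<exists>d\<in>{x, v}. safe (insert e0 R \<union> spokes v T) (spokes x S \<union> spokes v (S - T)) d"
      by (rule ds.preference_ends_safely[OF rd(1) R2 less.prems(4) e1(2) vR rd(3)]) blast
    have none: "spokes v {} = {}" by (simp add: spokes_def)
    have "reply k R (spokes x S \<union> spokes v {})"
      by (rule ds.battle[OF rd(1) R2 less.prems(4) e1(2) vR X safe, where T = "{}"])
        (simp_all add: none less.prems)
    then show ?thesis by (simp add: none)
  next
    case False
    then have lt: "card S < 2 * t - 1" using less.prems(3) by simp
    have eq: "insert {x, v} (spokes x S) = spokes x (insert v S)" by (simp add: spokes_insert)
    have xv: "{x, v} \<notin> R" using v(2) by auto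
    show ?thesis
    proof (rule replyI[OF less.prems(6) _ xv])
      show "{x, v} \<in> E" using x(1) v by simp
      show "{x, v} \<notin> spokes x S" using vS by simp
      fix k' e assume k': "k = Suc k'" and e: "e \<in> E" "e \<notin> R"
        and rm': "room k' (insert e R) (insert {x, v} (spokes x S))"
      have c: "card (insert e R) = Suc (card (insert v S))"
        using e rd(4) less.prems(5) vS fS by simp
      have "\<not> win (insert e R)"
        using e rd(1) c vS fS lt t3 by (intro no_win_if_few) auto
      moreover have "reply k' (insert e R) (spokes x (insert v S))"
      proof (rule less.IH)
        show "room k' (insert e R) (spokes x (insert v S))" using rm' eq by simp
        show "card (insert v S) \<le> 2 * t - 1" using lt vS fS by simp
      qed (use k' c v less.prems in auto)
      ultimately show "\<not> win (insert e R) \<and> reply k' (insert e R) (insert {x, v} (spokes x S))"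
        by (simp add: eq)
    qed
  qed
qed

lemma reply_to_first_edge:
  assumes "e1 \<in> nsets VA 2" "4 * k + 5 \<le> n"
  shows "\<not> win {e1}" "reply k {e1} {}"
proof -
  show "\<not> win {e1}" using assms t3 by (intro no_win_if_few) auto
  obtain x where "x \<in> VB" using card_VB assms by fastforce
  have none: "spokes x {} = {}" by (simp add: spokes_def)
  have "room k {e1} (spokes x {})" unfolding room_def none using assms by auto
  then have "reply k {e1} (spokes x {})"
    using \<open>x \<in> VB\<close> assms by (intro star_opening[of x "{}" e1]) (auto simp: nsets_def)
  then show "reply k {e1} {}" unfolding none .
qed

end

section \<open>Two complete graphs\<close>

lemma image_nsets: "inj f \<Longrightarrow> (\<lambda>e. f ` e) ` nsets A k = nsets (f ` A) k"
proof (intro subset_antisym subsetI)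
  assume f: "inj f"
  show "X \<in> nsets (f ` A) k" if "X \<in> (\<lambda>e. f ` e) ` nsets A k" for X
    using that f by (auto simp: nsets_def card_image inj_on_subset)
  show "X \<in> (\<lambda>e. f ` e) ` nsets A k" if "X \<in> nsets (f ` A) k" for X
  proof -
    from that obtain Y where Y: "Y \<subseteq> A" "X = f ` Y" by (auto simp: nsets_def subset_image_iff)
    then have "Y \<in> nsets A k"
      using that f by (auto simp: nsets_def card_image inj_on_subset finite_image_iff)
    then show ?thesis using Y by blast
  qed
qed

text \<open>
  The vertices \<open>LA 1\<close> and \<open>LA 2\<close> become the big and the small centre. Since every vertex of the target
  lies on an edge, the vertices of a copy are automatically vertices of the board.
\<close>

lemma contains_copy_K2_iff:
  assumes t: "t \<ge> 3" and G: "\<Union> G \<subseteq> verts Bd"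
  shows "contains_copy (Bd\<lparr>edges := G\<rparr>) (K2 (t + 1) (t - 2)) \<longleftrightarrow> (\<exists>a b K. target_copy t a b K \<and> K \<subseteq> G)"
    (is "?L \<longleftrightarrow> ?R")
proof
  assume ?L
  let ?V = "verts (K2 (t + 1) (t - 2))"
  from \<open>?L\<close> obtain f where inj: "inj_on f ?V" and ed: "\<And>e. e \<in> edges (K2 (t + 1) (t - 2)) \<Longrightarrow> f ` e \<in> G"
    unfolding contains_copy_def by auto
  define N where "N = f ` LB ` {1..t + 1}"
  define P where "P = f ` LC ` {1..t - 2}"
  have V: "LA 1 \<in> ?V" "LA 2 \<in> ?V" "LB ` {1..t + 1} \<subseteq> ?V" "LC ` {1..t - 2} \<subseteq> ?V"
    by (auto simp: K2_def)
  have "card N = card (LB ` {1..t + 1})" unfolding N_def by (rule card_image[OF inj_on_subset[OF inj V(3)]])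
  then have cN: "card N = t + 1" by (simp add: card_image inj_on_def)
  have "card P = card (LC ` {1..t - 2})" unfolding P_def by (rule card_image[OF inj_on_subset[OF inj V(4)]])
  then have cP: "card P = t - 2" by (simp add: card_image inj_on_def)
  have neq: "f u \<noteq> f v" if "u \<in> ?V" "v \<in> ?V" "u \<noteq> v" for u v
    using inj that by (auto simp: inj_on_def)
  have "N \<inter> P = {}" unfolding N_def P_def using neq V(3,4) by (auto simp: subset_iff)
  moreover have "f (LA 1) \<noteq> f (LA 2)" using neq V by simp
  moreover have "f (LA 1) \<notin> N \<union> P" "f (LA 2) \<notin> N \<union> P"
    unfolding N_def P_def using neq V by (auto simp: subset_iff)
  ultimately have "target_copy t (f (LA 1)) (f (LA 2)) (spokes (f (LA 1)) (N \<union> P) \<union> spokes (f (LA 2)) N)"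
    unfolding target_copy_def using cN cP by (intro exI[of _ N] exI[of _ P]) (simp add: N_def P_def)
  moreover have "spokes (f (LA 1)) (N \<union> P) \<union> spokes (f (LA 2)) N \<subseteq> G"
  proof -
    have B: "{f (LA i), f (LB j)} \<in> G" if "i \<in> {1..2}" "j \<in> {1..t + 1}" for i j
    proof -
      have "{LA i, LB j} \<in> edges (K2 (t + 1) (t - 2))" unfolding K2_def using that by auto
      from ed[OF this] show ?thesis by simp
    qed
    have C: "{f (LA 1), f (LC j)} \<in> G" if "j \<in> {1..t - 2}" for j
    proof -
      have "{LA 1, LC j} \<in> edges (K2 (t + 1) (t - 2))" unfolding K2_def using that by auto
      from ed[OF this] show ?thesis by simp
    qed
    show ?thesis using B[of 1] B[of 2] C unfolding N_def P_def by (auto simp: in_spokes)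
  qed
  ultimately show ?R by blast
next
  assume ?R
  then obtain a b K where K: "target_copy t a b K" "K \<subseteq> G" by blast
  then obtain N P where NP: "finite N" "finite P" "card N = t + 1" "card P = t - 2" "N \<inter> P = {}" "a \<noteq> b"
    "a \<notin> N \<union> P" "b \<notin> N \<union> P" "K = spokes a (N \<union> P) \<union> spokes b N"
    unfolding target_copy_def by auto
  obtain g where g: "bij_betw g {1..t + 1} N" using ex_bij_betw_nat_finite_1[OF NP(1)] NP(3) by auto
  obtain h where h: "bij_betw h {1..t - 2} P" using ex_bij_betw_nat_finite_1[OF NP(2)] NP(4) by auto
  have gN: "g j \<in> N" if "j \<in> {1..t + 1}" for j using g that by (auto simp: bij_betw_def)
  have hP: "h j \<in> P" if "j \<in> {1..t - 2}" for j using h that by (auto simp: bij_betw_def)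
  define f where "f l = (case l of LA i \<Rightarrow> if i = 1 then a else b | LB j \<Rightarrow> g j | LC j \<Rightarrow> h j)" for l
  let ?V = "verts (K2 (t + 1) (t - 2))"
  have Vcases: "v = LA 1 \<or> v = LA 2 \<or> (\<exists>j\<in>{1..t + 1}. v = LB j) \<or> (\<exists>j\<in>{1..t - 2}. v = LC j)"
    if "v \<in> ?V" for v
  proof -
    have "{1..2::nat} = {1, 2}" by auto
    then show ?thesis using that by (auto simp: K2_def)
  qed
  have f: "f (LA 1) = a" "f (LA 2) = b" "f (LB j) = g j" "f (LC j) = h j" for j
    by (simp_all add: f_def)
  have gi: "g i = g j \<longleftrightarrow> i = j" if "i \<in> {1..t + 1}" "j \<in> {1..t + 1}" for i j
    using bij_betw_imp_inj_on[OF g] that by (simp add: inj_on_eq_iff)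
  have hi: "h i = h j \<longleftrightarrow> i = j" if "i \<in> {1..t - 2}" "j \<in> {1..t - 2}" for i j
    using bij_betw_imp_inj_on[OF h] that by (simp add: inj_on_eq_iff)
  have gh: "g i \<noteq> h j" if "i \<in> {1..t + 1}" "j \<in> {1..t - 2}" for i j
    using gN[OF that(1)] hP[OF that(2)] NP(5) by auto
  have ab: "a \<noteq> g i" "b \<noteq> g i" "g i \<noteq> a" "g i \<noteq> b" if "i \<in> {1..t + 1}" for i using gN[OF that] NP(7,8) by auto
  have ab': "a \<noteq> h i" "b \<noteq> h i" "h i \<noteq> a" "h i \<noteq> b" if "i \<in> {1..t - 2}" for i using hP[OF that] NP(7,8) by auto
  have "inj_on f ?V"
  proof (rule inj_onI)
    fix u v assume uv: "u \<in> ?V" "v \<in> ?V" "f u = f v"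
    from Vcases[OF uv(1)] Vcases[OF uv(2)] uv(3) show "u = v"
      by (elim disjE bexE; simp only: f gi hi) (use NP(6) gh ab ab' in \<open>metis\<close>)+
  qed
  moreover have "f ` ?V \<subseteq> verts (Bd\<lparr>edges := G\<rparr>)"
  proof -
    have "f v \<in> \<Union> K" if v: "v \<in> ?V" for v
    proof -
      have 1: "{a, z} \<in> K" if "z \<in> N \<union> P" for z using NP(9) that by simp
      have 2: "{b, z} \<in> K" if "z \<in> N" for z using NP(9) that by simp
      have "g 1 \<in> N" by (rule gN) simp
      then have "a \<in> \<Union> K" "b \<in> \<Union> K" using 1[of "g 1"] 2[of "g 1"] by auto
      moreover have "z \<in> \<Union> K" if "z \<in> N \<union> P" for z using 1[OF that] by auto
      ultimately show ?thesis using Vcases[OF v] gN hP f by auto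
    qed
    then show ?thesis using K(2) G by auto
  qed
  moreover have "f ` e \<in> G" if "e \<in> edges (K2 (t + 1) (t - 2))" for e
  proof -
    have two: "{1..2::nat} = {1, 2}" by auto
    from that have "(\<exists>j\<in>{1..t + 1}. e = {LA 1, LB j} \<or> e = {LA 2, LB j}) \<or> (\<exists>j\<in>{1..t - 2}. e = {LA 1, LC j})"
      unfolding K2_def two by auto
    then have "f ` e \<in> K"
      using gN hP f NP(9) by auto
    then show ?thesis using K(2) by auto
  qed
  ultimately show ?L unfolding contains_copy_def by auto
qed

theorem theorem1p3:
  fixes t C :: nat
  assumes "t \<ge> 3"
  shows "\<exists>n0. \<forall>n\<ge>n0.
           L (disjoint_union (complete_graph n) (complete_graph n)) (K2 (t + 1) (t - 2)) > enat C"
proof (intro exI[of _ "4 * C + 1"] allI impI)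
  \<comment> \<open>Four vertices for each of the \<open>C\<close> rounds; \<open>VA\<close> and \<open>VB\<close> are interchanged if the game opens in \<open>VB\<close>.\<close>
  fix n :: nat assume n: "n \<ge> 4 * C + 1"
  let ?Bd = "disjoint_union (complete_graph n) (complete_graph n)"
  let ?H = "K2 (t + 1) (t - 2)"
  define VA :: "(nat + nat) set" where "VA = Inl ` {..<n}"
  define VB :: "(nat + nat) set" where "VB = Inr ` {..<n}"
  define win where "win = (\<lambda>G. contains_copy (?Bd\<lparr>edges := G\<rparr>) ?H)"
  have verts: "verts ?Bd = VA \<union> VB"
    by (auto simp: disjoint_union_def complete_graph_def VA_def VB_def)
  have edges: "edges ?Bd = nsets VA 2 \<union> nsets VB 2"
    by (simp add: disjoint_union_def complete_graph_def VA_def VB_def image_nsets)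
  have win_iff: "win G \<longleftrightarrow> (\<exists>a b K. target_copy t a b K \<and> K \<subseteq> G)" if "G \<subseteq> nsets VA 2 \<union> nsets VB 2" for G
    unfolding win_def
    using that assms by (intro contains_copy_K2_iff) (auto simp: verts nsets_def)
  interpret AB: board VA VB n t win
    using assms win_iff by unfold_locales (auto simp: VA_def VB_def card_image)
  interpret BA: board VB VA n t win
    using assms win_iff by unfold_locales (auto simp: VA_def VB_def card_image Un_commute)
  have "\<not> win {}" using assms by (intro AB.no_win_if_few) auto
  moreover have "survives (edges ?Bd) win C {} {}"
  proof (cases C)
    case (Suc k)
    then have k: "4 * k + 5 \<le> n" using n by simp
    show ?thesis unfolding Suc survives_Suc
    proof
      fix e assume "e \<in> edges ?Bd - {} - {}"
      then consider "e \<in> nsets VA 2" | "e \<in> nsets VB 2" unfolding edges by auto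
      then show "\<not> win (insert e {}) \<and> can_reply (edges ?Bd) win k (insert e {}) {}"
      proof cases
        case 1
        then show ?thesis unfolding edges using AB.reply_to_first_edge[OF 1 k] by simp
      next
        case 2
        have eq: "edges ?Bd = nsets VB 2 \<union> nsets VA 2" unfolding edges by (rule Un_commute)
        show ?thesis unfolding eq using BA.reply_to_first_edge[OF 2 k] by simp
      qed
    qed
  qed simp
  ultimately show "L ?Bd ?H > enat C"
    unfolding win_def by (intro survives_imp_L_greater)
qed

end
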